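(* (i) For any $h\in\mathcal H$ there exists a unique matrix Wiener-Hopf factorisation of $Q_h$, denoted by $(\eta_h^+,Q_h^+,\eta_h^-,Q_h^-)$. (ii) If $h=\Re(h)$ (i.e. $h$ is real-valued), then $Q_h^+\in\mathbb G(N^+)$ and $Q_h^-\in\mathbb G(N^-)$ are sub-generator matrices, and $\eta_h^+\in\mathbb H(N,N^+)$ and $\eta_h^-\in\mathbb H(N,N^-)$ are, in block notation, given by $$\eta_h^+=\begin{pmatrix} I_+\\ \underline\eta_h^+\end{pmatrix},\qquad \eta_h^-=\begin{pmatrix}\underline\eta_h^-\\ I_-\end{pmatrix},$$ for some matrices $\underline\eta_h^+\in\mathbb H(\underline N^-,N^+)$ and $\underline\eta_h^-\in\mathbb H(\underline N^+,N^-)$, where $I_+$ and $I_-$ are identity matrices of sizes $N^+\times N^+$ and $N^-\times N^-$.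
   Context: Let $Z$ be a continuous-time Markov chain on $E^0=\{1,\dots,N_0\}$ with generator $Q$, and let $X_t=x+\int_0^t\mu(Z_s)\,ds+\int_0^t\sigma(Z_s)\,dW_s+\sum_{i\in E^0}\int_0^t I_{\{Z_s=i\}}\,dJ^i_s$, where $W$ is a Brownian motion, $\sigma>0$, and the $J^i$ are independent compound Poisson processes with intensity $\lambda_i$ and double phase-type jump law with parameters $(p_i,\beta_i^+,B_i^+,\beta_i^-,B_i^-)$ (upward jumps $PH(\beta_i^+,B_i^+)$ with probability $p_i$, downward jumps minus a $PH(\beta_i^-,B_i^-)$ variable with probability $1-p_i$). Define, in block notation, $$Q_0=\begin{pmatrix}B^+ & b^+ & O\\ A^+ & Q-\Lambda_\lambda & A^-\\ O & b^- & B^-\end{pmatrix},\quad \Sigma=\begin{pmatrix}O&O&O\\O&\Lambda_S&O\\O&O&O\end{pmatrix},\quad V=\begin{pmatrix}I&O&O\\O&\Lambda_M&O\\O&O&-I\end{pmatrix},$$ where $\Lambda_\lambda,\Lambda_S,\Lambda_M$ are diagonal with entries $\lambda_i,\sigma(i),\mu(i)$; $A^\pm=\mathrm{diag}(\lambda_i^\pm(\beta_i^\pm)')$, $B^\pm=\mathrm{diag}(B_i^\pm)$, $b^\pm=\mathrm{diag}(-B_i^\pm\mathbf 1)$ (block diagonal), $\lambda_i^+=\lambda_ip_i$, $\lambda_i^-=\lambda_i(1-p_i)$. $Q_0$ is a generator on a state space $E$, partitioned as $E^0=\{i:\Sigma_{ii}\neq0\}$, $E^+=\{i:\Sigma_{ii}=0,V_{ii}>0\}$,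 $E^-=\{i:\Sigma_{ii}=0,V_{ii}<0\}$. Let $N,N^+,\underline N^+,N^-,\underline N^-$ be the cardinalities of $E$, $E^0\cup E^+$, $E^+$, $E^0\cup E^-$, $E^-$. Let $\mathcal H=\{h:E\to\mathbb C:\min_{i\in E}\Re h(i)\ge0,\ \min_{i\in E^0}\Re h(i)>0\}$, $\Lambda_h=\mathrm{diag}(h(i))$ and $Q_h=Q_0-\Lambda_h$. $\mathbb D(n)$ denotes $n\times n$ complex matrices whose eigenvalues all have non-positive real part, $\mathbb G(n)$ the $n\times n$ sub-generator matrices (non-negative off-diagonal entries, non-positive row sums), $\mathbb H(n,m)$ the $n\times m$ sub-probability matrices (non-negative entries, row sums $\le1$). A quadruple $(W^+,G^+,W^-,G^-)$ with $W^+\in\mathbb C^{N\times N^+}$, $G^+\in\mathbb D(N^+)$, $W^-\in\mathbb C^{N\times N^-}$, $G^-\in\mathbb D(N^-)$ is a matrix Wiener-Hopf factorisation of $Q_h$ if $\tfrac12\Sigma^2W^+(G^+)^2-VW^+G^++Q_hW^+=O$ and $\tfrac12\Sigma^2W^-(G^-)^2+VW^-G^-+Q_hW^-=O$ (zero matrices of sizes $N\times N^+$ and $N\times N^-$).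
   Formalization: A matrix Wiener-Hopf factorisation is required in addition to have identity rows of W⁺ on E⁰∪E⁺ and of W⁻ on E⁰∪E⁻; without this normalisation uniqueness in (i) fails, since W⁺=O, W⁻=O with any G⁺, G⁻ in 𝔻 also solve the equations. *)

theory Defs
  imports "Jordan_Normal_Form.Char_Poly"
begin

definition dmat :: "nat \<Rightarrow> (nat \<Rightarrow> 'a::zero) \<Rightarrow> 'a mat" where
  "dmat n f = mat n n (\<lambda>(i,j). if i = j then f i else 0)"

definition hstack :: "'a::zero mat \<Rightarrow> 'a mat \<Rightarrow> 'a mat" where
  "hstack X Y = four_block_mat X Y (0\<^sub>m 0 (dim_col X)) (0\<^sub>m 0 (dim_col Y))"

definition vstack :: "'a::zero mat \<Rightarrow> 'a mat \<Rightarrow> 'a mat" where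
  "vstack X Y = four_block_mat X (0\<^sub>m (dim_row X) 0) Y (0\<^sub>m (dim_row Y) 0)"

definition block3 :: "'a::zero mat \<Rightarrow> 'a mat \<Rightarrow> 'a mat \<Rightarrow> 'a mat \<Rightarrow> 'a mat \<Rightarrow> 'a mat
   \<Rightarrow> 'a mat \<Rightarrow> 'a mat \<Rightarrow> 'a mat \<Rightarrow> 'a mat" where
  "block3 M11 M12 M13 M21 M22 M23 M31 M32 M33 =
     four_block_mat (four_block_mat M11 M12 M21 M22) (vstack M13 M23) (hstack M31 M32) M33"

definition generator_real :: "nat \<Rightarrow> real mat \<Rightarrow> bool" where
  "generator_real n A \<longleftrightarrow> A \<in> carrier_mat n n \<and>
     (\<forall>i<n. \<forall>j<n. i \<noteq> j \<longrightarrow> A $$ (i,j) \<ge> 0) \<and>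
     (\<forall>i<n. (\<Sum>j<n. A $$ (i,j)) = 0)"

definition subgen_real :: "nat \<Rightarrow> real mat \<Rightarrow> bool" where
  "subgen_real n A \<longleftrightarrow> A \<in> carrier_mat n n \<and>
     (\<forall>i<n. \<forall>j<n. i \<noteq> j \<longrightarrow> A $$ (i,j) \<ge> 0) \<and>
     (\<forall>i<n. (\<Sum>j<n. A $$ (i,j)) \<le> 0)"

definition ph_params :: "nat \<Rightarrow> real vec \<Rightarrow> real mat \<Rightarrow> bool" where
  "ph_params m beta B \<longleftrightarrow> beta \<in> carrier_vec m \<and> (\<forall>k<m. beta $ k \<ge> 0) \<and>
     (\<Sum>k<m. beta $ k) = 1 \<and> subgen_real m B \<and> invertible_mat B"

definition in_D :: "nat \<Rightarrow> complex mat \<Rightarrow> bool" where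
  "in_D n A \<longleftrightarrow> A \<in> carrier_mat n n \<and> (\<forall>k. eigenvalue A k \<longrightarrow> Re k \<le> 0)"

definition in_G :: "nat \<Rightarrow> complex mat \<Rightarrow> bool" where
  "in_G n A \<longleftrightarrow> A \<in> carrier_mat n n \<and> (\<forall>i<n. \<forall>j<n. Im (A $$ (i,j)) = 0) \<and>
     (\<forall>i<n. \<forall>j<n. i \<noteq> j \<longrightarrow> Re (A $$ (i,j)) \<ge> 0) \<and>
     (\<forall>i<n. (\<Sum>j<n. Re (A $$ (i,j))) \<le> 0)"

definition in_H :: "nat \<Rightarrow> nat \<Rightarrow> complex mat \<Rightarrow> bool" where
  "in_H n m A \<longleftrightarrow> A \<in> carrier_mat n m \<and> (\<forall>i<n. \<forall>j<m. Im (A $$ (i,j)) = 0) \<and>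
     (\<forall>i<n. \<forall>j<m. Re (A $$ (i,j)) \<ge> 0) \<and>
     (\<forall>i<n. (\<Sum>j<m. Re (A $$ (i,j))) \<le> 1)"

text \<open>Regimes are indexed 0..<N0.  The state space E = {0..<N} is ordered in the block
  order of the paper: first the phases of all upward PH laws (regime 0 first, ...),
  then the N0 regime states, then the phases of all downward PH laws.\<close>

definition mtot :: "nat \<Rightarrow> (nat \<Rightarrow> nat) \<Rightarrow> nat" where
  "mtot N0 m = (\<Sum>i<N0. m i)"

definition Nstates :: "nat \<Rightarrow> (nat \<Rightarrow> nat) \<Rightarrow> (nat \<Rightarrow> nat) \<Rightarrow> nat" where
  "Nstates N0 mp mm = mtot N0 mp + N0 + mtot N0 mm"

definition Bblock :: "nat \<Rightarrow> (nat \<Rightarrow> real mat) \<Rightarrow> real mat" where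
  "Bblock N0 B = diag_block_mat (map B [0..<N0])"

definition bblock :: "nat \<Rightarrow> (nat \<Rightarrow> nat) \<Rightarrow> (nat \<Rightarrow> real mat) \<Rightarrow> real mat" where
  "bblock N0 m B = diag_block_mat
     (map (\<lambda>i. mat (m i) 1 (\<lambda>(r,_). - (\<Sum>c<m i. B i $$ (r,c)))) [0..<N0])"

definition Ablock :: "nat \<Rightarrow> (nat \<Rightarrow> nat) \<Rightarrow> (nat \<Rightarrow> real) \<Rightarrow> (nat \<Rightarrow> real vec) \<Rightarrow> real mat" where
  "Ablock N0 m l beta = diag_block_mat
     (map (\<lambda>i. mat 1 (m i) (\<lambda>(_,c). l i * beta i $ c)) [0..<N0])"

definition Q0_mat :: "nat \<Rightarrow> real mat \<Rightarrow> (nat \<Rightarrow> real) \<Rightarrow> (nat \<Rightarrow> real) \<Rightarrow>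
    (nat \<Rightarrow> nat) \<Rightarrow> (nat \<Rightarrow> real vec) \<Rightarrow> (nat \<Rightarrow> real mat) \<Rightarrow>
    (nat \<Rightarrow> nat) \<Rightarrow> (nat \<Rightarrow> real vec) \<Rightarrow> (nat \<Rightarrow> real mat) \<Rightarrow> real mat" where
  "Q0_mat N0 Q lam p mp betap Bp mm betam Bm =
     block3 (Bblock N0 Bp) (bblock N0 mp Bp) (0\<^sub>m (mtot N0 mp) (mtot N0 mm))
            (Ablock N0 mp (\<lambda>i. lam i * p i) betap) (Q - dmat N0 lam)
            (Ablock N0 mm (\<lambda>i. lam i * (1 - p i)) betam)
            (0\<^sub>m (mtot N0 mm) (mtot N0 mp)) (bblock N0 mm Bm) (Bblock N0 Bm)"

definition Sigma_mat :: "nat \<Rightarrow> (nat \<Rightarrow> real) \<Rightarrow> (nat \<Rightarrow> nat) \<Rightarrow> (nat \<Rightarrow> nat) \<Rightarrow> real mat" where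
  "Sigma_mat N0 sigma mp mm = block3
     (0\<^sub>m (mtot N0 mp) (mtot N0 mp)) (0\<^sub>m (mtot N0 mp) N0) (0\<^sub>m (mtot N0 mp) (mtot N0 mm))
     (0\<^sub>m N0 (mtot N0 mp)) (dmat N0 sigma) (0\<^sub>m N0 (mtot N0 mm))
     (0\<^sub>m (mtot N0 mm) (mtot N0 mp)) (0\<^sub>m (mtot N0 mm) N0) (0\<^sub>m (mtot N0 mm) (mtot N0 mm))"

definition V_mat :: "nat \<Rightarrow> (nat \<Rightarrow> real) \<Rightarrow> (nat \<Rightarrow> nat) \<Rightarrow> (nat \<Rightarrow> nat) \<Rightarrow> real mat" where
  "V_mat N0 mu mp mm = block3
     (1\<^sub>m (mtot N0 mp)) (0\<^sub>m (mtot N0 mp) N0) (0\<^sub>m (mtot N0 mp) (mtot N0 mm))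
     (0\<^sub>m N0 (mtot N0 mp)) (dmat N0 mu) (0\<^sub>m N0 (mtot N0 mm))
     (0\<^sub>m (mtot N0 mm) (mtot N0 mp)) (0\<^sub>m (mtot N0 mm) N0) (- 1\<^sub>m (mtot N0 mm))"

definition E0_set :: "real mat \<Rightarrow> nat set" where
  "E0_set S = {k. k < dim_row S \<and> S $$ (k,k) \<noteq> 0}"

definition Eplus_set :: "real mat \<Rightarrow> real mat \<Rightarrow> nat set" where
  "Eplus_set S V = {k. k < dim_row S \<and> S $$ (k,k) = 0 \<and> V $$ (k,k) > 0}"

definition Eminus_set :: "real mat \<Rightarrow> real mat \<Rightarrow> nat set" where
  "Eminus_set S V = {k. k < dim_row S \<and> S $$ (k,k) = 0 \<and> V $$ (k,k) < 0}"

definition in_calH :: "real mat \<Rightarrow> (nat \<Rightarrow> complex) \<Rightarrow> bool" where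
  "in_calH S h \<longleftrightarrow> (\<forall>k<dim_row S. Re (h k) \<ge> 0) \<and> (\<forall>k\<in>E0_set S. Re (h k) > 0)"

text \<open>Matrix Wiener-Hopf factorisation of \<open>Qh\<close> (N x N complex) with respect to
  (Sigma, V), with column dimensions Np = N^+ and Nm = N^-.  Following the paper's
  definition, W^+ and W^- are normalised to the block forms (I_+ ; *) and (* ; I_-),
  i.e. the rows of W^+ indexed by E^0 \<union> E^+ (the first Np states) form the identity
  and the rows of W^- indexed by E^0 \<union> E^- (the last Nm states) form the identity.\<close>
definition is_mat_WH :: "complex mat \<Rightarrow> complex mat \<Rightarrow> complex mat \<Rightarrow> nat \<Rightarrow> nat \<Rightarrow>
    complex mat \<Rightarrow> complex mat \<Rightarrow> complex mat \<Rightarrow> complex mat \<Rightarrow> bool" where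
  "is_mat_WH Sg Vm Qh Np Nm Wp Gp Wm Gm \<longleftrightarrow>
     (let N = dim_row Qh in
      Wp \<in> carrier_mat N Np \<and> in_D Np Gp \<and> Wm \<in> carrier_mat N Nm \<and> in_D Nm Gm \<and>
      (\<forall>i<Np. \<forall>j<Np. Wp $$ (i,j) = (if i = j then 1 else 0)) \<and>
      (\<forall>i<Nm. \<forall>j<Nm. Wm $$ (N - Nm + i, j) = (if i = j then 1 else 0)) \<and>
      (1/2) \<cdot>\<^sub>m (Sg * Sg * Wp * (Gp * Gp)) - Vm * Wp * Gp + Qh * Wp = 0\<^sub>m N Np \<and>
      (1/2) \<cdot>\<^sub>m (Sg * Sg * Wm * (Gm * Gm)) + Vm * Wm * Gm + Qh * Wm = 0\<^sub>m N Nm)"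

end

theory Submission
  imports Defs "Jordan_Normal_Form.Spectral_Radius"
begin

text \<open>
  For \<open>c\<close> large put \<open>G = c (R - I)\<close>.  Each row of the Wiener-Hopf equation can then be solved
  for one of its terms so that the pair \<open>(W, R)\<close> becomes a fixed point of a quadratic map.  When
  \<open>h\<close> is real this map has non-negative coefficients and preserves the sub-probability
  matrices; for complex \<open>h\<close> its coefficients are dominated in modulus by those of the problem with
  \<open>h\<close> replaced by \<open>Re h - \<epsilon>\<close>.  Hence the iterates started at zero, and also their increments, are
  dominated by a bounded monotone sequence, which gives existence, together with the sign and row sum
  properties in the real case.  The slack \<open>\<epsilon>\<close> comes from a weight \<open>d > 0\<close> with
  \<open>(Q0 - Re h) d < 0\<close>: phase-type laws are transient, so \<open>d = 1 + \<delta> w\<close> with \<open>w = - B\<inverse> 1\<close> on the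
  phases and \<open>w = 0\<close> on the regimes.

  For uniqueness, strict diagonal dominance in the weight \<open>d\<close> excludes eigenvalues of \<open>G\<close> on the imaginary
  axis, so for \<open>c\<close> large the powers of \<open>R\<close> and \<open>R'\<close> are bounded.  The differences
  \<open>W R^m - W' R'^m\<close> satisfy the linearised equation for all \<open>m\<close> and vanish at \<open>m = 0\<close> on the
  normalised rows; a maximum principle forces them to be zero.
\<close>

subsection \<open>A quadratic fixed-point equation\<close>

text \<open>One unknown \<open>U\<close> carries both matrices of a half: its rows in the image of
  \<open>e\<close> hold \<open>R\<close>, its other rows hold the free rows of \<open>W\<close>.
  Putting the identity rows back in yields the full \<open>W\<close>.\<close>

definition fixrows :: "nat \<Rightarrow> (nat \<Rightarrow> nat) \<Rightarrow> (nat \<Rightarrow> nat \<Rightarrow> 'a::zero_neq_one) \<Rightarrow> nat \<Rightarrow> nat \<Rightarrow> 'a" where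
  "fixrows n e U l j = (if l \<in> e ` {..<n} then of_bool (l = e j) else U l j)"

text \<open>On a normalised row the first sum is a row of \<open>R R\<close>, on a free row it is a
  row of \<open>W R\<close>; the second sum is linear in \<open>W\<close>. One formula thus covers
  both kinds of rows of the solved equation.\<close>

definition wstep :: "nat \<Rightarrow> nat \<Rightarrow> (nat \<Rightarrow> nat) \<Rightarrow> (nat \<Rightarrow> 'a) \<Rightarrow> (nat \<Rightarrow> nat \<Rightarrow> 'a)
    \<Rightarrow> (nat \<Rightarrow> nat \<Rightarrow> 'a::field) \<Rightarrow> nat \<Rightarrow> nat \<Rightarrow> 'a" where
  "wstep N n e \<alpha> \<gamma> U i j =
     \<alpha> i * (\<Sum>k<n. U i k * U (e k) j) + (\<Sum>l<N. \<gamma> i l * fixrows n e U l j)"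

definition witer :: "nat \<Rightarrow> nat \<Rightarrow> (nat \<Rightarrow> nat) \<Rightarrow> (nat \<Rightarrow> 'a) \<Rightarrow> (nat \<Rightarrow> nat \<Rightarrow> 'a)
    \<Rightarrow> nat \<Rightarrow> nat \<Rightarrow> nat \<Rightarrow> 'a::field" where
  "witer N n e \<alpha> \<gamma> m = (wstep N n e \<alpha> \<gamma> ^^ m) (\<lambda>_ _. 0)"

lemma witer_0: "witer N n e \<alpha> \<gamma> 0 = (\<lambda>_ _. 0)"
  and witer_Suc: "witer N n e \<alpha> \<gamma> (Suc m) = wstep N n e \<alpha> \<gamma> (witer N n e \<alpha> \<gamma> m)"
  by (simp_all add: witer_def)

lemma witer_of_real:
  "witer N n e (\<lambda>i. of_real (\<alpha> i)) (\<lambda>i l. of_real (\<gamma> i l)) m i j =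
   (of_real (witer N n e \<alpha> \<gamma> m i j) :: 'a::real_normed_field)"
proof (induction m arbitrary: i j)
  case (Suc m)
  have "fixrows n e (\<lambda>i j. of_real (U i j)) l j = (of_real (fixrows n e U l j) :: 'a)" for U l j
    by (simp add: fixrows_def)
  moreover have "witer N n e (\<lambda>i. of_real (\<alpha> i)) (\<lambda>i l. of_real (\<gamma> i l)) m =
      (\<lambda>i j. (of_real (witer N n e \<alpha> \<gamma> m i j) :: 'a))"
    by (intro ext) (rule Suc)
  ultimately show ?case by (simp add: witer_Suc wstep_def)
qed (simp add: witer_0)

lemma norm_mult_le:
  fixes x y :: "'a::real_normed_field"
  assumes "norm x \<le> a" "norm y \<le> b"
  shows "norm (x * y) \<le> a * b"
proof -
  have "0 \<le> a" using norm_ge_zero assms(1) by (rule order_trans)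
  then show ?thesis unfolding norm_mult using assms by (intro mult_mono) auto
qed

section \<open>Domination of the complex iteration by a monotone real one\<close>

locale majorised_step =
  fixes N n :: nat and e :: "nat \<Rightarrow> nat"
    and \<alpha> :: "nat \<Rightarrow> complex" and \<gamma> :: "nat \<Rightarrow> nat \<Rightarrow> complex"
    and \<alpha>' :: "nat \<Rightarrow> real" and \<gamma>' :: "nat \<Rightarrow> nat \<Rightarrow> real" and d :: "nat \<Rightarrow> real"
  assumes e_less: "k < n \<Longrightarrow> e k < N"
    and e_inj: "inj_on e {..<n}"
    and norm_\<alpha>: "i < N \<Longrightarrow> norm (\<alpha> i) \<le> \<alpha>' i"
    and norm_\<gamma>: "i < N \<Longrightarrow> l < N \<Longrightarrow> norm (\<gamma> i l) \<le> \<gamma>' i l"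
    and d_pos: "i < N \<Longrightarrow> 0 < d i"
    and weight: "i < N \<Longrightarrow> \<alpha>' i * d i + (\<Sum>l<N. \<gamma>' i l * d l) \<le> d i"
begin

abbreviation "X \<equiv> witer N n e \<alpha> \<gamma>"
abbreviation "Y \<equiv> witer N n e \<alpha>' \<gamma>'"

lemma \<alpha>'_nonneg: "i < N \<Longrightarrow> 0 \<le> \<alpha>' i"
  using norm_\<alpha>[of i] norm_ge_zero[of "\<alpha> i"] by linarith

lemma \<gamma>'_nonneg: "i < N \<Longrightarrow> l < N \<Longrightarrow> 0 \<le> \<gamma>' i l"
  using norm_\<gamma>[of i l] norm_ge_zero[of "\<gamma> i l"] by linarith

lemma wstep_norm_le:
  assumes "\<And>i j. i < N \<Longrightarrow> j < n \<Longrightarrow> norm (U i j) \<le> V i j" and i: "i < N" and j: "j < n"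
  shows "norm (wstep N n e \<alpha> \<gamma> U i j) \<le> wstep N n e \<alpha>' \<gamma>' V i j"
proof -
  have f: "norm (fixrows n e U l j) \<le> fixrows n e V l j" if "l < N" for l
    using assms(1)[OF that j] by (simp add: fixrows_def)
  have "norm (\<Sum>k<n. U i k * U (e k) j) \<le> (\<Sum>k<n. V i k * V (e k) j)"
    using i j by (intro sum_norm_le norm_mult_le assms(1) e_less) auto
  moreover have "norm (\<Sum>l<N. \<gamma> i l * fixrows n e U l j) \<le> (\<Sum>l<N. \<gamma>' i l * fixrows n e V l j)"
    using i by (intro sum_norm_le norm_mult_le f norm_\<gamma>) auto
  ultimately show ?thesis unfolding wstep_def
    using i by (intro norm_triangle_le add_mono norm_mult_le norm_\<alpha>) auto
qed

lemma wstep_diff_norm_le: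
  assumes U: "\<And>i j. i < N \<Longrightarrow> j < n \<Longrightarrow> norm (U i j) \<le> V i j"
    and U': "\<And>i j. i < N \<Longrightarrow> j < n \<Longrightarrow> norm (U' i j) \<le> V' i j"
    and D: "\<And>i j. i < N \<Longrightarrow> j < n \<Longrightarrow> norm (U' i j - U i j) \<le> V' i j - V i j"
    and i: "i < N" and j: "j < n"
  shows "norm (wstep N n e \<alpha> \<gamma> U' i j - wstep N n e \<alpha> \<gamma> U i j)
    \<le> wstep N n e \<alpha>' \<gamma>' V' i j - wstep N n e \<alpha>' \<gamma>' V i j"
proof -
  have f: "norm (fixrows n e U' l j - fixrows n e U l j) \<le> fixrows n e V' l j - fixrows n e V l j"
    if "l < N" for l
    using D[OF that j] by (simp add: fixrows_def)
  have "norm (U' i k * U' (e k) j - U i k * U (e k) j) \<le> V' i k * V' (e k) j - V i k * V (e k) j"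
    if k: "k < n" for k
  proof -
    \<comment> \<open>Each summand has one factor that is a difference, so the three domination
      hypotheses apply to the factors; the same splitting of the products of \<open>V'\<close> and
      \<open>V\<close> gives the bound.\<close>
    have "U' i k * U' (e k) j - U i k * U (e k) j =
        U' i k * (U' (e k) j - U (e k) j) + (U' i k - U i k) * U (e k) j"
      by (simp add: algebra_simps)
    moreover have "norm (U' i k * (U' (e k) j - U (e k) j)) \<le> V' i k * (V' (e k) j - V (e k) j)"
      using i j k by (intro norm_mult_le U' D e_less) auto
    moreover have "norm ((U' i k - U i k) * U (e k) j) \<le> (V' i k - V i k) * V (e k) j"
      using i j k by (intro norm_mult_le U D e_less) auto
    ultimately have "norm (U' i k * U' (e k) j - U i k * U (e k) j) \<le>
        V' i k * (V' (e k) j - V (e k) j) + (V' i k - V i k) * V (e k) j"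
      by (simp only: norm_triangle_le[OF add_mono])
    then show ?thesis by (simp add: algebra_simps)
  qed
  then have 1: "norm ((\<Sum>k<n. U' i k * U' (e k) j) - (\<Sum>k<n. U i k * U (e k) j))
      \<le> (\<Sum>k<n. V' i k * V' (e k) j) - (\<Sum>k<n. V i k * V (e k) j)"
    unfolding sum_subtractf[symmetric] by (intro sum_norm_le) auto
  have 2: "norm ((\<Sum>l<N. \<gamma> i l * fixrows n e U' l j) - (\<Sum>l<N. \<gamma> i l * fixrows n e U l j))
      \<le> (\<Sum>l<N. \<gamma>' i l * fixrows n e V' l j) - (\<Sum>l<N. \<gamma>' i l * fixrows n e V l j)"
    unfolding sum_subtractf[symmetric] right_diff_distrib[symmetric]
    using i by (intro sum_norm_le norm_mult_le f norm_\<gamma>) auto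
  have eq: "wstep N n e \<alpha> \<gamma> U' i j - wstep N n e \<alpha> \<gamma> U i j =
     \<alpha> i * ((\<Sum>k<n. U' i k * U' (e k) j) - (\<Sum>k<n. U i k * U (e k) j)) +
     ((\<Sum>l<N. \<gamma> i l * fixrows n e U' l j) - (\<Sum>l<N. \<gamma> i l * fixrows n e U l j))"
    by (simp only: wstep_def right_diff_distrib add_diff_add)
  have eq': "wstep N n e \<alpha>' \<gamma>' V' i j - wstep N n e \<alpha>' \<gamma>' V i j =
     \<alpha>' i * ((\<Sum>k<n. V' i k * V' (e k) j) - (\<Sum>k<n. V i k * V (e k) j)) +
     ((\<Sum>l<N. \<gamma>' i l * fixrows n e V' l j) - (\<Sum>l<N. \<gamma>' i l * fixrows n e V l j))"
    by (simp only: wstep_def right_diff_distrib add_diff_add)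
  show ?thesis unfolding eq eq'
    by (rule norm_triangle_le[OF add_mono[OF norm_mult_le[OF norm_\<alpha>[OF i] 1] 2]])
qed

lemma norm_witer_le: "i < N \<Longrightarrow> j < n \<Longrightarrow> norm (X m i j) \<le> Y m i j"
proof (induction m arbitrary: i j)
  case (Suc m)
  then show ?case unfolding witer_Suc by (intro wstep_norm_le) auto
qed (simp add: witer_0)

lemma witer_diff_norm_le:
  "i < N \<Longrightarrow> j < n \<Longrightarrow> norm (X (Suc m) i j - X m i j) \<le> Y (Suc m) i j - Y m i j"
proof (induction m arbitrary: i j)
  case 0
  then show ?case using norm_witer_le[of i j 1] by (simp add: witer_0)
next
  case (Suc m)
  \<comment> \<open>Only the outermost step of each iterate is unfolded, so that both sides become
    differences of \<open>wstep\<close> at consecutive iterates.\<close>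
  show ?case unfolding witer_Suc[of _ _ _ _ _ "Suc m"]
    by (subst (2) witer_Suc, subst (3) witer_Suc, rule wstep_diff_norm_le)
      (use Suc norm_witer_le in auto)
qed

lemma Y_nonneg: "i < N \<Longrightarrow> j < n \<Longrightarrow> 0 \<le> Y m i j"
  using norm_witer_le[of i j m] norm_ge_zero[of "X m i j"] by linarith

text \<open>A reinserted identity row has weighted sum exactly \<open>d l\<close>, so restoring the
  normalisation does not spoil the bound.\<close>

lemma fixrows_weight:
  assumes "\<And>i. i < N \<Longrightarrow> (\<Sum>j<n. V i j * d (e j)) \<le> d i" and l: "l < N"
  shows "(\<Sum>j<n. fixrows n e V l j * d (e j)) \<le> d l"
proof (cases "l \<in> e ` {..<n}")
  case True
  then obtain k where k: "k < n" "l = e k" by auto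
  have "(\<Sum>j<n. fixrows n e V l j * d (e j)) = (\<Sum>j<n. if j = k then d (e k) else 0)"
    using True k e_inj by (intro sum.cong) (auto simp: fixrows_def inj_on_def)
  then show ?thesis using k by simp
qed (use assms in \<open>simp add: fixrows_def\<close>)

text \<open>The weight \<open>d\<close> plays the role of a superharmonic function: row sums
  weighted by it never grow beyond \<open>d\<close> along the iteration. This is the source of all
  bounds on the iterates.\<close>

lemma Y_weight: "i < N \<Longrightarrow> (\<Sum>j<n. Y m i j * d (e j)) \<le> d i"
proof (induction m arbitrary: i)
  case 0
  then show ?case using d_pos[of i] by (simp add: witer_0)
next
  case (Suc m)
  let ?V = "Y m"
  have "(\<Sum>j<n. wstep N n e \<alpha>' \<gamma>' ?V i j * d (e j)) =
      \<alpha>' i * (\<Sum>j<n. \<Sum>k<n. ?V i k * ?V (e k) j * d (e j)) +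
      (\<Sum>j<n. \<Sum>l<N. \<gamma>' i l * fixrows n e ?V l j * d (e j))"
    by (simp add: wstep_def algebra_simps sum.distrib sum_distrib_left sum_distrib_right)
  also have "(\<Sum>j<n. \<Sum>k<n. ?V i k * ?V (e k) j * d (e j)) =
      (\<Sum>k<n. ?V i k * (\<Sum>j<n. ?V (e k) j * d (e j)))"
    by (subst sum.swap) (simp add: sum_distrib_left mult_ac)
  also have "(\<Sum>j<n. \<Sum>l<N. \<gamma>' i l * fixrows n e ?V l j * d (e j)) =
      (\<Sum>l<N. \<gamma>' i l * (\<Sum>j<n. fixrows n e ?V l j * d (e j)))"
    by (subst sum.swap) (simp add: sum_distrib_left mult_ac)
  \<comment> \<open>The induction hypothesis at row \<open>e k\<close> absorbs the inner factor of
    the product; applied again at row \<open>i\<close> it absorbs the outer one, and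
    \<open>weight\<close> closes the cycle.\<close>
  also have "\<alpha>' i * (\<Sum>k<n. ?V i k * (\<Sum>j<n. ?V (e k) j * d (e j))) +
      (\<Sum>l<N. \<gamma>' i l * (\<Sum>j<n. fixrows n e ?V l j * d (e j)))
    \<le> \<alpha>' i * (\<Sum>k<n. ?V i k * d (e k)) + (\<Sum>l<N. \<gamma>' i l * d l)"
    using Suc.prems
    by (intro add_mono mult_left_mono sum_mono Suc.IH e_less Y_nonneg \<alpha>'_nonneg \<gamma>'_nonneg
        fixrows_weight) auto
  also have "\<dots> \<le> \<alpha>' i * d i + (\<Sum>l<N. \<gamma>' i l * d l)"
    using Suc by (intro add_mono mult_left_mono \<alpha>'_nonneg) auto
  also have "\<dots> \<le> d i" using weight Suc.prems by simp
  finally show ?case by (simp add: witer_Suc)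
qed

lemma Y_bounded: assumes "i < N" "j < n" shows "Y m i j \<le> d i / d (e j)"
proof -
  have "Y m i j * d (e j) \<le> (\<Sum>j<n. Y m i j * d (e j))"
    using assms by (intro member_le_sum)
      (auto intro!: mult_nonneg_nonneg Y_nonneg less_imp_le[OF d_pos] e_less)
  then show ?thesis using Y_weight[of i m] d_pos[OF e_less] assms
    by (simp add: pos_le_divide_eq)
qed

text \<open>The real iterates increase and are bounded, so their increments are summable. They
  dominate the complex increments, which are therefore absolutely summable and telescope to
  \<open>X\<close>.\<close>

lemma witer_convergent: assumes "i < N" "j < n" shows "convergent (\<lambda>m. X m i j)"
proof -
  have "incseq (\<lambda>m. Y m i j)"
  proof (rule incseq_SucI)
    fix m show "Y m i j \<le> Y (Suc m) i j"
      using witer_diff_norm_le[OF assms, of m] norm_ge_zero[of "X (Suc m) i j - X m i j"] by linarith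
  qed
  then have "convergent (\<lambda>m. Y m i j)"
    using Y_bounded[OF assms] by (elim incseq_convergent) (auto intro: convergentI)
  then have "summable (\<lambda>m. Y (Suc m) i j - Y m i j)"
    using telescope_summable convergent_LIMSEQ_iff by blast
  then have "summable (\<lambda>m. X (Suc m) i j - X m i j)"
    by (rule summable_comparison_test'[where N = 0]) (use witer_diff_norm_le[OF assms] in auto)
  then have "convergent (\<lambda>m. \<Sum>k<m. X (Suc k) i j - X k i j)"
    by (simp add: summable_iff_convergent)
  then show ?thesis unfolding sum_lessThan_telescope[of "\<lambda>m. X m i j"] by (simp add: witer_0)
qed

definition "Xlim i j = lim (\<lambda>m. X m i j)"

lemma tendsto_Xlim: "i < N \<Longrightarrow> j < n \<Longrightarrow> (\<lambda>m. X m i j) \<longlonglongrightarrow> Xlim i j"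
  using witer_convergent convergent_LIMSEQ_iff unfolding Xlim_def by blast

lemma Xlim_fixpoint: assumes "i < N" "j < n" shows "Xlim i j = wstep N n e \<alpha> \<gamma> Xlim i j"
proof -
  have f: "(\<lambda>m. fixrows n e (X m) l j) \<longlonglongrightarrow> fixrows n e Xlim l j" if "l < N" for l
    using tendsto_Xlim[OF that assms(2)] by (auto simp: fixrows_def)
  have "(\<lambda>m. X (Suc m) i j) \<longlonglongrightarrow> wstep N n e \<alpha> \<gamma> Xlim i j"
    unfolding witer_Suc wstep_def
    by (intro tendsto_add tendsto_mult tendsto_sum tendsto_const f tendsto_Xlim e_less assms) auto
  moreover have "(\<lambda>m. X (Suc m) i j) \<longlonglongrightarrow> Xlim i j"
    using tendsto_Xlim[OF assms] by (rule LIMSEQ_Suc)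
  ultimately show ?thesis using LIMSEQ_unique by blast
qed

text \<open>On the normalised rows this bounds the spectrum of \<open>R\<close> by the unit circle;
  with \<open>d\<close> constantly one it is the row sum bound for sub-probability matrices.\<close>

lemma Xlim_weight: assumes "i < N" shows "(\<Sum>j<n. norm (Xlim i j) * d (e j)) \<le> d i"
proof (rule LIMSEQ_le_const2)
  show "(\<lambda>m. \<Sum>j<n. norm (X m i j) * d (e j)) \<longlonglongrightarrow> (\<Sum>j<n. norm (Xlim i j) * d (e j))"
    by (intro tendsto_sum tendsto_mult tendsto_norm tendsto_const tendsto_Xlim assms) auto
  have "(\<Sum>j<n. norm (X m i j) * d (e j)) \<le> d i" for m
  proof -
    have "(\<Sum>j<n. norm (X m i j) * d (e j)) \<le> (\<Sum>j<n. Y m i j * d (e j))"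
      using assms by (intro sum_mono mult_right_mono norm_witer_le less_imp_le[OF d_pos] e_less) auto
    then show ?thesis using Y_weight[OF assms, of m] by linarith
  qed
  then show "\<exists>M. \<forall>m\<ge>M. (\<Sum>j<n. norm (X m i j) * d (e j)) \<le> d i" by blast
qed

text \<open>When the coefficients coincide with their majorants, the complex iteration is the real
  dominating one, whose iterates are non-negative.\<close>

lemma Xlim_nonneg:
  assumes "i < N" "j < n"
    and "\<alpha> = (\<lambda>i. of_real (\<alpha>' i))" "\<gamma> = (\<lambda>i l. of_real (\<gamma>' i l))"
  shows "Im (Xlim i j) = 0" "0 \<le> Re (Xlim i j)"
proof -
  have *: "X m i j = of_real (Y m i j)" for m
    unfolding assms(3,4) by (rule witer_of_real)
  have "(\<lambda>m. Im (X m i j)) \<longlonglongrightarrow> Im (Xlim i j)" "(\<lambda>m. Re (X m i j)) \<longlonglongrightarrow> Re (Xlim i j)"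
    by (rule tendsto_Im tendsto_Re, rule tendsto_Xlim[OF assms(1,2)])+
  then have lims: "(\<lambda>m. 0) \<longlonglongrightarrow> Im (Xlim i j)" "(\<lambda>m. Y m i j) \<longlonglongrightarrow> Re (Xlim i j)"
    by (simp_all only: * Im_complex_of_real Re_complex_of_real)
  show "Im (Xlim i j) = 0"
    using lims(1) by (simp add: LIMSEQ_const_iff)
  show "0 \<le> Re (Xlim i j)"
    using Y_nonneg[OF assms(1,2)] by (intro LIMSEQ_le_const[OF lims(2)]) simp
qed

end

subsection \<open>Coefficients of the transformed equation\<close>

text \<open>The coefficient of the term for which a row is solved: \<open>W R\<close> on a
  normalised row, \<open>W\<close> on a free row. The type is left general so that the problem with
  complex \<open>h\<close> and its real majorant are given by the same formula.\<close>

definition wden :: "nat \<Rightarrow> (nat \<Rightarrow> nat) \<Rightarrow> (nat \<Rightarrow> real) \<Rightarrow> (nat \<Rightarrow> real) \<Rightarrow> (nat \<Rightarrow> nat \<Rightarrow> real)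
    \<Rightarrow> (nat \<Rightarrow> 'a::real_normed_field) \<Rightarrow> real \<Rightarrow> nat \<Rightarrow> 'a" where
  "wden n e a v q h c i =
     (if i \<in> e ` {..<n} then of_real (2 * a i * c\<^sup>2 + v i * c) else of_real (c - q i i) + h i)"

definition walpha :: "nat \<Rightarrow> (nat \<Rightarrow> nat) \<Rightarrow> (nat \<Rightarrow> real) \<Rightarrow> (nat \<Rightarrow> real) \<Rightarrow> (nat \<Rightarrow> nat \<Rightarrow> real)
    \<Rightarrow> (nat \<Rightarrow> 'a::real_normed_field) \<Rightarrow> real \<Rightarrow> nat \<Rightarrow> 'a" where
  "walpha n e a v q h c i =
     of_real (if i \<in> e ` {..<n} then a i * c\<^sup>2 else c) / wden n e a v q h c i"

definition wgamma :: "nat \<Rightarrow> (nat \<Rightarrow> nat) \<Rightarrow> (nat \<Rightarrow> real) \<Rightarrow> (nat \<Rightarrow> real) \<Rightarrow> (nat \<Rightarrow> nat \<Rightarrow> real)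
    \<Rightarrow> (nat \<Rightarrow> 'a::real_normed_field) \<Rightarrow> real \<Rightarrow> nat \<Rightarrow> nat \<Rightarrow> 'a" where
  "wgamma n e a v q h c i l =
     (if l \<noteq> i then of_real (q i l)
      else if i \<in> e ` {..<n} then of_real (a i * c\<^sup>2 + v i * c + q i i) - h i
      else 0) / wden n e a v q h c i"

lemma wden_of_real: "wden n e a v q (\<lambda>i. of_real (h i)) c i = of_real (wden n e a v q h c i)"
  by (simp add: wden_def)

lemma walpha_of_real: "walpha n e a v q (\<lambda>i. of_real (h i)) c i = of_real (walpha n e a v q h c i)"
  by (simp add: walpha_def wden_of_real)

lemma wgamma_of_real:
  "wgamma n e a v q (\<lambda>i. of_real (h i)) c i l = of_real (wgamma n e a v q h c i l)"
  by (simp add: wgamma_def wden_of_real)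

text \<open>The full row of \<open>q\<close> is restored by correcting the diagonal term. On a free
  row \<open>q i i\<close> has moved into the denominator and \<open>wgamma\<close> vanishes on the
  diagonal, hence the correction by \<open>- q i i\<close>.\<close>

lemma wgamma_sum:
  assumes "i < N"
  shows "(\<Sum>l<N. wgamma n e a v q h c i l * x l) =
    ((\<Sum>l<N. of_real (q i l) * x l) +
      (if i \<in> e ` {..<n} then of_real (a i * c\<^sup>2 + v i * c) - h i else - of_real (q i i)) * x i)
    / wden n e a v q h c i"
proof -
  have "(\<Sum>l\<in>{..<N} - {i}. wgamma n e a v q h c i l * x l) =
      (\<Sum>l\<in>{..<N} - {i}. of_real (q i l) * x l) / wden n e a v q h c i"
    unfolding sum_divide_distrib by (intro sum.cong) (auto simp: wgamma_def)
  then show ?thesis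
    using assms
    by (simp add: sum.remove[of "{..<N}" i] wgamma_def add_divide_distrib diff_divide_distrib
        ring_distribs)
qed

text \<open>Rows of the Wiener-Hopf equation after the substitution \<open>G = c (R - I)\<close>, with
  \<open>x0\<close>, \<open>x1\<close>, \<open>x2\<close> a column of \<open>W\<close>, \<open>W R\<close>, \<open>W R R\<close>.  Each row is solved for the term that
  leaves coefficients of modulus at most those of the real problem.\<close>

lemma row_equation_iff:
  fixes x0 x1 x2 :: "nat \<Rightarrow> 'a::real_normed_field"
  assumes i: "i < N" and den: "wden n e a v q h c i \<noteq> 0"
    and off: "i \<notin> e ` {..<n} \<Longrightarrow> a i = 0 \<and> v i = -1"
  shows "of_real (a i) * (of_real c ^ 2 * (x2 i - 2 * x1 i + x0 i))
      - of_real (v i) * (of_real c * (x1 i - x0 i))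
      + (\<Sum>l<N. of_real (q i l) * x0 l) - h i * x0 i = 0 \<longleftrightarrow>
    (if i \<in> e ` {..<n} then x1 i else x0 i) =
      walpha n e a v q h c i * (if i \<in> e ` {..<n} then x2 i else x1 i)
      + (\<Sum>l<N. wgamma n e a v q h c i l * x0 l)"
proof -
  let ?S = "\<Sum>l<N. of_real (q i l) * x0 l" and ?D = "wden n e a v q h c i"
  have eqn: "walpha n e a v q h c i * y + (\<Sum>l<N. wgamma n e a v q h c i l * x0 l) =
    (of_real (if i \<in> e ` {..<n} then a i * c\<^sup>2 else c) * y + (?S +
      (if i \<in> e ` {..<n} then of_real (a i * c\<^sup>2 + v i * c) - h i else - of_real (q i i)) * x0 i))
    / ?D" for y
    by (simp only: walpha_def wgamma_sum[OF i] times_divide_eq_left add_divide_distrib)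
  show ?thesis
  proof (cases "i \<in> e ` {..<n}")
    case True
    have D: "?D = of_real (2 * a i * c\<^sup>2 + v i * c)" using True by (simp add: wden_def)
    have "of_real (a i) * (of_real c ^ 2 * (x2 i - 2 * x1 i + x0 i))
      - of_real (v i) * (of_real c * (x1 i - x0 i)) + ?S - h i * x0 i =
      (of_real (a i * c\<^sup>2) * x2 i + (?S + (of_real (a i * c\<^sup>2 + v i * c) - h i) * x0 i)) - x1 i * ?D"
      unfolding D by (simp add: algebra_simps)
    then show ?thesis
      unfolding eqn nonzero_eq_divide_eq[OF den] by (simp only: True if_True right_minus_eq) (rule eq_commute)
  next
    case False
    have D: "?D = of_real (c - q i i) + h i" using False by (simp add: wden_def)
    have "of_real (a i) * (of_real c ^ 2 * (x2 i - 2 * x1 i + x0 i))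
      - of_real (v i) * (of_real c * (x1 i - x0 i)) + ?S - h i * x0 i =
      (of_real c * x1 i + (?S + (- of_real (q i i)) * x0 i)) - x0 i * ?D"
      unfolding D using off[OF False] by (simp add: algebra_simps)
    then show ?thesis
      unfolding eqn nonzero_eq_divide_eq[OF den] by (simp only: False if_False right_minus_eq) (rule eq_commute)
  qed
qed

text \<open>If \<open>W\<close>, \<open>W R\<close> and \<open>W R R\<close> are all replaced by
  \<open>d\<close>, the difference terms carrying \<open>a\<close> and \<open>v\<close> cancel. What
  remains is a drift inequality in which \<open>c\<close> no longer occurs, so one weight serves
  every large \<open>c\<close>.\<close>

lemma weight_iff:
  fixes h d :: "nat \<Rightarrow> real"
  assumes i: "i < N" and den: "0 < wden n e a v q h c i"
  shows "walpha n e a v q h c i * d i + (\<Sum>l<N. wgamma n e a v q h c i l * d l) \<le> d i \<longleftrightarrow>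
      (\<Sum>l<N. q i l * d l) \<le> h i * d i"
    and "walpha n e a v q h c i * d i + (\<Sum>l<N. wgamma n e a v q h c i l * d l) < d i \<longleftrightarrow>
      (\<Sum>l<N. q i l * d l) < h i * d i"
proof -
  let ?D = "wden n e a v q h c i"
  have eq: "walpha n e a v q h c i * d i + (\<Sum>l<N. wgamma n e a v q h c i l * d l) =
     ((if i \<in> e ` {..<n} then a i * c\<^sup>2 else c) * d i + ((\<Sum>l<N. q i l * d l) +
      (if i \<in> e ` {..<n} then (a i * c\<^sup>2 + v i * c) - h i else - (q i i)) * d i)) / ?D"
    by (simp only: walpha_def wgamma_sum[OF i] times_divide_eq_left add_divide_distrib
        of_real_eq_id id_apply)
  have D: "?D * d i = (if i \<in> e ` {..<n} then a i * c\<^sup>2 else c) * d i +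
     ((if i \<in> e ` {..<n} then (a i * c\<^sup>2 + v i * c) - h i else - (q i i)) * d i) + h i * d i"
    by (simp add: wden_def algebra_simps)
  show "walpha n e a v q h c i * d i + (\<Sum>l<N. wgamma n e a v q h c i l * d l) \<le> d i \<longleftrightarrow>
      (\<Sum>l<N. q i l * d l) \<le> h i * d i"
    unfolding eq using D by (simp only: pos_divide_le_eq[OF den] mult.commute[of "d i" ?D]) linarith
  show "walpha n e a v q h c i * d i + (\<Sum>l<N. wgamma n e a v q h c i l * d l) < d i \<longleftrightarrow>
      (\<Sum>l<N. q i l * d l) < h i * d i"
    unfolding eq using D by (simp only: pos_divide_less_eq[OF den] mult.commute[of "d i" ?D]) linarith
qed

text \<open>Far from the real number \<open>x\<close>, an imaginary part changes the modulus only to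
  second order. A fixed slack \<epsilon> therefore pays for it once \<open>x\<close> is large, which
  is how complex \<open>h\<close> gets dominated.\<close>

lemma norm_of_real_diff_le:
  fixes z :: complex
  assumes "0 \<le> x - Re z" "0 \<le> \<epsilon>" "(Im z)\<^sup>2 \<le> 2 * \<epsilon> * (x - Re z)"
  shows "norm (of_real x - z) \<le> x - Re z + \<epsilon>"
proof (rule power2_le_imp_le)
  have "(norm (of_real x - z))\<^sup>2 = (x - Re z)\<^sup>2 + (Im z)\<^sup>2" by (simp add: cmod_power2)
  also have "\<dots> \<le> (x - Re z + \<epsilon>)\<^sup>2"
    unfolding power2_sum[of "x - Re z" \<epsilon>] using assms(3) zero_le_power2[of \<epsilon>]
    by (simp only: mult.commute[of _ \<epsilon>] mult.left_commute[of _ \<epsilon>] mult.assoc)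
  finally show "(norm (of_real x - z))\<^sup>2 \<le> (x - Re z + \<epsilon>)\<^sup>2" .
qed (use assms in auto)

text \<open>Both halves of the factorisation are instances, the minus half with the sign of
  \<open>v\<close> reversed. Here \<open>a\<close> stands for half the squared volatility, and
  \<open>e\<close> enumerates the states whose rows of \<open>W\<close> are normalised; the other
  states carry no diffusion and move with unit speed in the opposite direction.\<close>

locale wh_system =
  fixes N n :: nat and e :: "nat \<Rightarrow> nat" and a v :: "nat \<Rightarrow> real" and q :: "nat \<Rightarrow> nat \<Rightarrow> real"
  assumes n_pos: "0 < n"
    and e_less: "k < n \<Longrightarrow> e k < N"
    and e_inj: "inj_on e {..<n}"
    and on_range: "k < n \<Longrightarrow> 0 < a (e k) \<or> a (e k) = 0 \<and> v (e k) = 1"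
    and off_range: "i < N \<Longrightarrow> i \<notin> e ` {..<n} \<Longrightarrow> a i = 0 \<and> v i = -1"
    and q_nonneg: "i < N \<Longrightarrow> l < N \<Longrightarrow> i \<noteq> l \<Longrightarrow> 0 \<le> q i l"
begin

abbreviation "D \<equiv> wden n e a v q"
abbreviation "A \<equiv> walpha n e a v q"
abbreviation "\<Gamma> \<equiv> wgamma n e a v q"

lemma N_pos: "0 < N" using e_less[OF n_pos] by linarith

lemma a_nonneg: "i < N \<Longrightarrow> 0 \<le> a i"
  using on_range off_range by (cases "i \<in> e ` {..<n}") force+

lemma eventually_quadratic_ge:
  assumes "i \<in> e ` {..<n}" shows "\<forall>\<^sub>F c in at_top. b \<le> a i * c\<^sup>2 + v i * c"
proof -
  consider "0 < a i" | "a i = 0" "v i = 1" using on_range assms by blast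
  then show ?thesis
  proof cases
    case 1
    show ?thesis
      \<comment> \<open>Beyond this threshold \<open>a i * c + v i\<close> is at least 1, so the
        quadratic is at least \<open>c\<close> and hence at least \<open>b\<close>.\<close>
      using eventually_ge_at_top[of "(1 - v i) / a i"] eventually_ge_at_top[of b] eventually_ge_at_top[of 0]
    proof eventually_elim
      case (elim c)
      then have "1 \<le> a i * c + v i" using 1 by (simp add: pos_divide_le_eq mult.commute)
      then have "c * 1 \<le> c * (a i * c + v i)" using elim by (intro mult_left_mono) auto
      then show ?case using elim by (simp add: algebra_simps power2_eq_square)
    qed
  next
    case 2
    then show ?thesis using eventually_ge_at_top[of b] by simp
  qed
qed

text \<open>All requirements that domination by the real problem with
  \<open>Re h - \<epsilon>\<close> puts on \<open>c\<close>. As an eventual property it can be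
  combined with further requirements when two solutions are compared.\<close>

definition good :: "(nat \<Rightarrow> complex) \<Rightarrow> real \<Rightarrow> real \<Rightarrow> bool" where
  "good h \<epsilon> c \<longleftrightarrow> 0 < c \<and> (\<forall>i<N. 0 < D (\<lambda>i. Re (h i) - \<epsilon>) c i \<and> D h c i \<noteq> 0 \<and>
     norm (A h c i) \<le> A (\<lambda>i. Re (h i) - \<epsilon>) c i \<and>
     (\<forall>l<N. norm (\<Gamma> h c i l) \<le> \<Gamma> (\<lambda>i. Re (h i) - \<epsilon>) c i l))"

text \<open>The alternative \<epsilon> = 0 for real \<open>h\<close> allows the constant weight one,
  which has no strict drift in general but yields the sharp row sums.\<close>

lemma eventually_good:
  assumes eps: "0 < \<epsilon> \<or> \<epsilon> = 0 \<and> (\<forall>i<N. Im (h i) = 0)"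
  shows "\<forall>\<^sub>F c in at_top. good h \<epsilon> c"
proof -
  let ?h' = "\<lambda>i. Re (h i) - \<epsilon>"
  have "\<forall>\<^sub>F c in at_top. \<forall>i\<in>{..<N}. 0 < D ?h' c i \<and> D h c i \<noteq> 0 \<and> norm (A h c i) \<le> A ?h' c i \<and>
     (\<forall>l<N. norm (\<Gamma> h c i l) \<le> \<Gamma> ?h' c i l)"
  proof (intro eventually_ball_finite ballI)
    fix i assume "i \<in> {..<N}"
    then have i: "i < N" by simp
    show "\<forall>\<^sub>F c in at_top. 0 < D ?h' c i \<and> D h c i \<noteq> 0 \<and> norm (A h c i) \<le> A ?h' c i \<and>
     (\<forall>l<N. norm (\<Gamma> h c i l) \<le> \<Gamma> ?h' c i l)"
    proof (cases "i \<in> e ` {..<n}")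
      case True
      show ?thesis
        \<comment> \<open>The bound 1 keeps the denominator positive. The other bound leaves the
          room \<open>(Im h)^2 / (2 \<epsilon>)\<close> that \<open>norm_of_real_diff_le\<close>
          demands for the diagonal coefficient.\<close>
        using eventually_gt_at_top[of 0] eventually_quadratic_ge[OF True, of 1]
          eventually_quadratic_ge[OF True, of "Re (h i) - q i i + (if \<epsilon> = 0 then 0 else (Im (h i))\<^sup>2 / (2 * \<epsilon>))"]
      proof eventually_elim
        case (elim c)
        have ac: "0 \<le> a i * c\<^sup>2" using a_nonneg[OF i] by simp
        have Dpos: "0 < 2 * a i * c\<^sup>2 + v i * c" using ac elim by linarith
        have D: "D ?h' c i = 2 * a i * c\<^sup>2 + v i * c" "D h c i = of_real (2 * a i * c\<^sup>2 + v i * c)"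
          using True by (simp_all add: wden_def)
        have "norm (of_real (a i * c\<^sup>2 + v i * c + q i i) - h i) \<le>
            (a i * c\<^sup>2 + v i * c + q i i) - Re (h i) + \<epsilon>"
        proof (rule norm_of_real_diff_le)
          show "0 \<le> a i * c\<^sup>2 + v i * c + q i i - Re (h i)"
            using elim(3) eps by (smt (verit) divide_nonneg_nonneg zero_le_power2)
          show "0 \<le> \<epsilon>" using eps by auto
          show "(Im (h i))\<^sup>2 \<le> 2 * \<epsilon> * (a i * c\<^sup>2 + v i * c + q i i - Re (h i))"
          proof (cases "\<epsilon> = 0")
            case False
            then have "(Im (h i))\<^sup>2 / (2 * \<epsilon>) \<le> a i * c\<^sup>2 + v i * c + q i i - Re (h i)"
              using elim(3) by simp
            then show ?thesis using False eps by (simp add: pos_divide_le_eq mult.commute)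
          qed (use eps i in auto)
        qed
        then have g: "norm (\<Gamma> h c i i) \<le> \<Gamma> ?h' c i i"
          using Dpos True by (simp add: wgamma_def D norm_divide divide_right_mono del: of_real_add of_real_mult)
        have "norm (\<Gamma> h c i l) \<le> \<Gamma> ?h' c i l" if "l < N" for l
          using g Dpos q_nonneg[OF i that]
          by (cases "l = i") (simp_all add: wgamma_def D norm_divide del: of_real_add of_real_mult)
        moreover have "norm (A h c i) \<le> A ?h' c i"
          using True Dpos ac by (simp add: walpha_def D norm_divide del: of_real_add of_real_mult)
        ultimately show ?case using Dpos by (simp add: D del: of_real_add of_real_mult)
      qed
    next
      case False
      show ?thesis
        using eventually_gt_at_top[of 0] eventually_gt_at_top[of "q i i - Re (h i) + \<epsilon>"]
      proof eventually_elim
        case (elim c)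
        have e0: "0 \<le> \<epsilon>" using eps by auto
        have D: "D ?h' c i = c - q i i + Re (h i) - \<epsilon>" "D h c i = of_real (c - q i i) + h i"
          using False by (simp_all add: wden_def)
        have Dpos: "0 < D ?h' c i" using elim D by simp
        \<comment> \<open>On a free row \<open>h\<close> enters only through the denominator, and
          replacing it by \<open>Re h - \<epsilon>\<close> can only make that denominator smaller in
          modulus.\<close>
        have "Re (of_real (c - q i i) + h i) \<le> norm (of_real (c - q i i) + h i)"
          by (rule complex_Re_le_cmod)
        then have Dn: "D ?h' c i \<le> norm (D h c i)" unfolding D using e0 by simp
        have "norm (of_real x / D h c i) \<le> x / D ?h' c i" if "0 \<le> x" for x :: real
          using that Dn Dpos by (simp add: norm_divide frac_le)
        then show ?case
          using Dpos Dn elim(1) q_nonneg[OF i] False by (auto simp: walpha_def wgamma_def)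
      qed
    qed
  qed simp
  then show ?thesis
    using eventually_gt_at_top[of 0] by eventually_elim (auto simp: good_def)
qed

end

subsection \<open>One half of the factorisation\<close>

text \<open>Written entry by entry, the diagonal matrices become plain row coefficients, and a sign
  change of \<open>v\<close> is all that separates the two halves. The spectral condition
  \<open>in_D\<close> is imposed separately.\<close>

definition whsol :: "nat \<Rightarrow> nat \<Rightarrow> (nat \<Rightarrow> nat) \<Rightarrow> (nat \<Rightarrow> real) \<Rightarrow> (nat \<Rightarrow> real) \<Rightarrow> (nat \<Rightarrow> nat \<Rightarrow> real)
    \<Rightarrow> (nat \<Rightarrow> complex) \<Rightarrow> complex mat \<Rightarrow> complex mat \<Rightarrow> bool" where
  "whsol N n e a v q h W G \<longleftrightarrow> W \<in> carrier_mat N n \<and> G \<in> carrier_mat n n \<and>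
     (\<forall>k<n. \<forall>j<n. W $$ (e k, j) = (if k = j then 1 else 0)) \<and>
     (\<forall>i<N. \<forall>j<n. of_real (a i) * (W * (G * G)) $$ (i,j) - of_real (v i) * (W * G) $$ (i,j)
        + (\<Sum>l<N. of_real (q i l) * W $$ (l,j)) - h i * W $$ (i,j) = 0)"

lemma whsol_cong:
  "(\<And>i. i < N \<Longrightarrow> h i = h' i) \<Longrightarrow> whsol N n e a v q h W G = whsol N n e a v q h' W G"
  by (simp add: whsol_def)

lemma mult_mat_index:
  "A \<in> carrier_mat l m \<Longrightarrow> B \<in> carrier_mat m r \<Longrightarrow> i < l \<Longrightarrow> j < r \<Longrightarrow>
   (A * B) $$ (i,j) = (\<Sum>k<m. A $$ (i,k) * B $$ (k,j))"
  by (auto simp: scalar_prod_def atLeast0LessThan intro!: sum.cong)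

lemma mult_mat_vec_index:
  "A \<in> carrier_mat l m \<Longrightarrow> x \<in> carrier_vec m \<Longrightarrow> i < l \<Longrightarrow>
   (A *\<^sub>v x) $ i = (\<Sum>k<m. A $$ (i,k) * x $ k)"
  by (auto simp: scalar_prod_def atLeast0LessThan intro!: sum.cong)

lemma shifted_carrier: "K \<in> carrier_mat n n \<Longrightarrow> c \<cdot>\<^sub>m (K - 1\<^sub>m n) \<in> carrier_mat n n"
  by (intro smult_carrier_mat minus_carrier_mat one_carrier_mat)

lemma mult_shifted:
  fixes W K :: "complex mat"
  assumes W: "W \<in> carrier_mat N n" and K: "K \<in> carrier_mat n n"
  shows "W * (c \<cdot>\<^sub>m (K - 1\<^sub>m n)) = c \<cdot>\<^sub>m (W * K - W)"
  by (simp only: mult_smult_distrib[OF W minus_carrier_mat[OF one_carrier_mat]]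
      mult_minus_distrib_mat[OF W K one_carrier_mat] right_mult_one_mat[OF W])

lemma mult_shifted_index:
  fixes W K :: "complex mat"
  assumes W: "W \<in> carrier_mat N n" and K: "K \<in> carrier_mat n n" and "i < N" "j < n"
  shows "(W * (c \<cdot>\<^sub>m (K - 1\<^sub>m n))) $$ (i,j) = c * ((W * K) $$ (i,j) - W $$ (i,j))"
  using assms by (simp add: mult_shifted[OF W K])

lemma mult_shifted_square_index:
  fixes W K :: "complex mat" and c :: complex
  assumes W: "W \<in> carrier_mat N n" and K: "K \<in> carrier_mat n n" and i: "i < N" and j: "j < n"
  defines "G \<equiv> c \<cdot>\<^sub>m (K - 1\<^sub>m n)"
  shows "(W * (G * G)) $$ (i,j) = c ^ 2 * ((W * K * K) $$ (i,j) - 2 * (W * K) $$ (i,j) + W $$ (i,j))"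
proof -
  have G: "G \<in> carrier_mat n n" unfolding G_def by (rule shifted_carrier[OF K])
  have WK: "W * K \<in> carrier_mat N n" and WG: "W * G \<in> carrier_mat N n" using W K G by auto
  have "W * G = c \<cdot>\<^sub>m (W * K - W)"
    unfolding G_def by (rule mult_shifted[OF W K])
  then have WGK: "W * G * K = c \<cdot>\<^sub>m (W * K * K - W * K)"
    by (simp only: mult_smult_assoc_mat[OF minus_carrier_mat[OF W] K] minus_mult_distrib_mat[OF WK W K])
  have WGK_index: "(W * G * K) $$ (i,j) = c * ((W * K * K) $$ (i,j) - (W * K) $$ (i,j))"
    unfolding WGK using W K i j by simp
  have WG_index: "(W * G) $$ (i,j) = c * ((W * K) $$ (i,j) - W $$ (i,j))"
    unfolding G_def by (rule mult_shifted_index[OF W K i j])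
  have "(W * (G * G)) $$ (i,j) = (W * G * G) $$ (i,j)"
    using assoc_mult_mat[OF W G G] by simp
  also have "\<dots> = c * ((W * G * K) $$ (i,j) - (W * G) $$ (i,j))"
    unfolding G_def by (rule mult_shifted_index[OF WG[unfolded G_def] K i j])
  also have "\<dots> = c ^ 2 * ((W * K * K) $$ (i,j) - 2 * (W * K) $$ (i,j) + W $$ (i,j))"
    unfolding WGK_index WG_index by (simp add: algebra_simps power2_eq_square)
  finally show ?thesis .
qed

section \<open>Maximum principle and eigenvalues\<close>

lemma obtain_max_index:
  fixes f :: "nat \<Rightarrow> real"
  assumes "0 < N"
  obtains i where "i < N" "\<And>l. l < N \<Longrightarrow> f l \<le> f i"
proof -
  have "Max (f ` {..<N}) \<in> f ` {..<N}" using assms by (intro Max_in) auto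
  then obtain i where i: "i < N" "Max (f ` {..<N}) = f i" by auto
  have "f l \<le> f i" if "l < N" for l unfolding i(2)[symmetric] using that by (intro Max_ge) auto
  then show ?thesis using that i(1) by blast
qed

text \<open>The maximum principle works at the row where \<open>|x i| / d i\<close> is largest:
  there the equation for \<open>x\<close> can be compared with the inequality for \<open>d\<close>,
  \<open>t\<close> being the maximal ratio.\<close>

lemma obtain_weighted_max:
  fixes x :: "nat \<Rightarrow> complex"
  assumes "\<And>i. i < N \<Longrightarrow> 0 < d i" and k: "k < N" "x k \<noteq> 0"
  obtains i t where "i < N" "0 < t" "norm (x i) = t * d i" "\<And>l. l < N \<Longrightarrow> norm (x l) \<le> t * d l"
proof -
  have "0 < N" using k by linarith
  then obtain i where i: "i < N" "\<And>l. l < N \<Longrightarrow> norm (x l) / d l \<le> norm (x i) / d i"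
    using obtain_max_index[of N "\<lambda>l. norm (x l) / d l"] by blast
  let ?t = "norm (x i) / d i"
  have "0 < norm (x k) / d k" using assms k by simp
  then have "0 < ?t" using i(2)[OF k(1)] by linarith
  moreover have "norm (x i) = ?t * d i" using assms(1)[OF i(1)] by simp
  moreover have "norm (x l) \<le> ?t * d l" if "l < N" for l
    using i(2)[OF that] assms(1)[OF that] by (simp only: pos_divide_le_eq)
  ultimately show ?thesis using that i(1) by blast
qed

lemma eigenvalueE:
  fixes A :: "complex mat"
  assumes "eigenvalue A s" and A: "A \<in> carrier_mat n n"
  obtains x k where "x \<in> carrier_vec n" "k < n" "x $ k \<noteq> 0" "A *\<^sub>v x = s \<cdot>\<^sub>v x"
    "\<And>i. i < n \<Longrightarrow> (\<Sum>j<n. A $$ (i,j) * x $ j) = s * x $ i"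
proof -
  obtain x where x: "x \<in> carrier_vec n" "x \<noteq> 0\<^sub>v n" "A *\<^sub>v x = s \<cdot>\<^sub>v x"
    using assms unfolding eigenvalue_def eigenvector_def by auto
  have "\<exists>k<n. x $ k \<noteq> 0"
  proof (rule ccontr)
    assume "\<not> (\<exists>k<n. x $ k \<noteq> 0)"
    then have "x = 0\<^sub>v n" using x(1) by (intro eq_vecI) auto
    then show False using x(2) by simp
  qed
  then obtain k where k: "k < n" "x $ k \<noteq> 0" by blast
  have "(\<Sum>j<n. A $$ (i,j) * x $ j) = s * x $ i" if "i < n" for i
    using mult_mat_vec_index[OF A x(1) that] x(1,3) that by simp
  then show ?thesis using that x k by blast
qed

lemma eigenvalueI:
  fixes A :: "complex mat"
  assumes A: "A \<in> carrier_mat n n" and x: "x \<in> carrier_vec n" "k < n" "x $ k \<noteq> 0"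
    and "\<And>i. i < n \<Longrightarrow> (\<Sum>j<n. A $$ (i,j) * x $ j) = s * x $ i"
  shows "eigenvalue A s"
proof -
  have "A *\<^sub>v x = s \<cdot>\<^sub>v x"
    using A x by (intro eq_vecI) (auto simp: mult_mat_vec_index[OF A x(1)] assms(5) simp del: index_mult_mat_vec)
  moreover have "x \<noteq> 0\<^sub>v n" using x by auto
  ultimately show ?thesis using A x unfolding eigenvalue_def eigenvector_def by auto
qed

lemma sum_shifted:
  fixes K :: "complex mat"
  assumes K: "K \<in> carrier_mat n n" and i: "i < n"
  shows "(\<Sum>j<n. (c \<cdot>\<^sub>m (K - 1\<^sub>m n)) $$ (i,j) * x j) = c * ((\<Sum>j<n. K $$ (i,j) * x j) - x i)"
proof -
  have "(\<Sum>j<n. (c \<cdot>\<^sub>m (K - 1\<^sub>m n)) $$ (i,j) * x j) =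
      (\<Sum>j<n. c * (K $$ (i,j) * x j) - (if j = i then c * x i else 0))"
    using K i by (intro sum.cong) (auto simp: algebra_simps)
  then show ?thesis using i by (simp add: sum_subtractf sum_distrib_left right_diff_distrib)
qed

text \<open>Both matrices have the same eigenvectors, and their eigenvalues correspond under an
  affine map. Disc conditions on \<open>K\<close> thereby translate into half-plane conditions on
  \<open>c (K - I)\<close>.\<close>

lemma eigenvalue_shifted_iff:
  fixes K :: "complex mat"
  assumes K: "K \<in> carrier_mat n n" and c: "c \<noteq> 0"
  shows "eigenvalue (c \<cdot>\<^sub>m (K - 1\<^sub>m n)) (c * (s - 1)) \<longleftrightarrow> eigenvalue K s"
proof -
  let ?G = "c \<cdot>\<^sub>m (K - 1\<^sub>m n)"
  have G: "?G \<in> carrier_mat n n" by (rule shifted_carrier[OF K])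
  have *: "(\<Sum>j<n. ?G $$ (i,j) * x $ j) = c * (s - 1) * x $ i \<longleftrightarrow> (\<Sum>j<n. K $$ (i,j) * x $ j) = s * x $ i"
    if "i < n" for i and x :: "complex vec"
    unfolding sum_shifted[OF K that] using c by (simp add: algebra_simps)
  show ?thesis
  proof
    assume "eigenvalue ?G (c * (s - 1))"
    then show "eigenvalue K s"
      by (rule eigenvalueE[OF _ G]) (rule eigenvalueI[OF K], assumption+, simp only: *)
  next
    assume "eigenvalue K s"
    then show "eigenvalue ?G (c * (s - 1))"
      by (rule eigenvalueE[OF _ K]) (rule eigenvalueI[OF G], assumption+, simp only: *)
  qed
qed

text \<open>The hypothesis bounds the operator norm of \<open>K\<close> for the maximum norm
  weighted by \<open>w\<close>; evaluating an eigenvector where its weighted modulus is maximal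
  gives the claim.\<close>

lemma eigenvalue_norm_le_1:
  fixes K :: "complex mat"
  assumes K: "K \<in> carrier_mat n n" and w: "\<And>k. k < n \<Longrightarrow> 0 < w k"
    and le: "\<And>k. k < n \<Longrightarrow> (\<Sum>j<n. norm (K $$ (k,j)) * w j) \<le> w k"
    and ev: "eigenvalue K s"
  shows "norm s \<le> 1"
proof -
  obtain x k where x: "k < n" "x $ k \<noteq> 0" "\<And>i. i < n \<Longrightarrow> (\<Sum>j<n. K $$ (i,j) * x $ j) = s * x $ i"
    using eigenvalueE[OF ev K] by metis
  obtain i t where i: "i < n" "0 < t" "norm (x $ i) = t * w i" "\<And>l. l < n \<Longrightarrow> norm (x $ l) \<le> t * w l"
    using obtain_weighted_max[of n w k "\<lambda>i. x $ i"] w x by metis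
  have "norm s * (t * w i) = norm (\<Sum>j<n. K $$ (i,j) * x $ j)"
    unfolding x(3)[OF i(1)] by (simp add: norm_mult i(3))
  also have "\<dots> \<le> (\<Sum>j<n. norm (K $$ (i,j)) * (t * w j))"
    by (intro sum_norm_le norm_mult_le i) auto
  also have "\<dots> = t * (\<Sum>j<n. norm (K $$ (i,j)) * w j)" by (simp add: sum_distrib_left mult_ac)
  also have "\<dots> \<le> t * w i" using le[OF i(1)] i(2) by simp
  finally have "norm s * (t * w i) \<le> 1 * (t * w i)" by simp
  moreover have "0 < t * w i" using i w by simp
  ultimately show ?thesis by (simp only: mult_le_cancel_right_pos)
qed

context wh_system
begin

text \<open>This is \<open>row_equation_iff\<close> applied to each column of \<open>W\<close>,
  \<open>W K\<close> and \<open>W K K\<close>.\<close>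

lemma whsol_shifted_iff:
  assumes c: "0 < c" and den: "\<And>i. i < N \<Longrightarrow> D h c i \<noteq> 0"
    and W: "W \<in> carrier_mat N n" and K: "K \<in> carrier_mat n n"
  shows "whsol N n e a v q h W (of_real c \<cdot>\<^sub>m (K - 1\<^sub>m n)) \<longleftrightarrow>
     (\<forall>k<n. \<forall>j<n. W $$ (e k, j) = (if k = j then 1 else 0)) \<and>
     (\<forall>i<N. \<forall>j<n. (if i \<in> e ` {..<n} then (W * K) $$ (i,j) else W $$ (i,j)) =
        A h c i * (if i \<in> e ` {..<n} then (W * K * K) $$ (i,j) else (W * K) $$ (i,j)) +
        (\<Sum>l<N. \<Gamma> h c i l * W $$ (l,j)))"
proof -
  let ?G = "of_real c \<cdot>\<^sub>m (K - 1\<^sub>m n) :: complex mat"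
  have G: "?G \<in> carrier_mat n n" by (rule shifted_carrier[OF K])
  have "of_real (a i) * (W * (?G * ?G)) $$ (i,j) - of_real (v i) * (W * ?G) $$ (i,j)
        + (\<Sum>l<N. of_real (q i l) * W $$ (l,j)) - h i * W $$ (i,j) = 0 \<longleftrightarrow>
     (if i \<in> e ` {..<n} then (W * K) $$ (i,j) else W $$ (i,j)) =
        A h c i * (if i \<in> e ` {..<n} then (W * K * K) $$ (i,j) else (W * K) $$ (i,j)) +
        (\<Sum>l<N. \<Gamma> h c i l * W $$ (l,j))" if i: "i < N" and j: "j < n" for i j
    unfolding mult_shifted_index[OF W K i j] mult_shifted_square_index[OF W K i j]
    using row_equation_iff[OF i den[OF i] off_range[OF i],
        of "\<lambda>i. (W * K * K) $$ (i,j)" "\<lambda>i. (W * K) $$ (i,j)" "\<lambda>i. W $$ (i,j)"] .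
  then show ?thesis unfolding whsol_def using W G by simp
qed

text \<open>Reads \<open>U\<close> as a pair: on normalised rows \<open>U\<close> is
  \<open>W K\<close>, on free rows it is \<open>W\<close>. With these identifications the
  fixed-point equation is the solved row equation.\<close>

lemma whsol_of_fixpoint:
  assumes c: "0 < c" and den: "\<And>i. i < N \<Longrightarrow> D h c i \<noteq> 0"
    and U: "\<And>i j. i < N \<Longrightarrow> j < n \<Longrightarrow> U i j = wstep N n e (A h c) (\<Gamma> h c) U i j"
  shows "whsol N n e a v q h (mat N n (\<lambda>(i,j). fixrows n e U i j))
     (of_real c \<cdot>\<^sub>m (mat n n (\<lambda>(k,j). U (e k) j) - 1\<^sub>m n))"
proof -
  let ?W = "mat N n (\<lambda>(i,j). fixrows n e U i j)" and ?K = "mat n n (\<lambda>(k,j). U (e k) j)"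
  have W: "?W \<in> carrier_mat N n" and K: "?K \<in> carrier_mat n n" by auto
  let ?S = "\<lambda>i j. \<Sum>k<n. U i k * U (e k) j"
  \<comment> \<open>A normalised row of \<open>W\<close> is a unit vector and selects the row of
    \<open>K\<close> stored in \<open>U\<close> at the same index.\<close>
  have WK: "(?W * ?K) $$ (i,j) = (if i \<in> e ` {..<n} then U i j else ?S i j)"
    if i: "i < N" and j: "j < n" for i j
  proof (cases "i \<in> e ` {..<n}")
    case True
    then obtain k where k: "k < n" "i = e k" by auto
    have "(?W * ?K) $$ (i,j) = (\<Sum>m<n. if m = k then U i j else 0)"
      unfolding mult_mat_index[OF W K i j]
      using True k i j e_inj by (intro sum.cong) (auto simp: fixrows_def inj_on_def)
    then show ?thesis using True k by simp
  next
    case False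
    then show ?thesis
      unfolding mult_mat_index[OF W K i j] using i j by (simp add: fixrows_def)
  qed
  have WK_c: "?W * ?K \<in> carrier_mat N n" by (rule mult_carrier_mat[OF W K])
  have WKK: "(?W * ?K * ?K) $$ (i,j) = ?S i j" if i: "i < N" and j: "j < n" and "i \<in> e ` {..<n}" for i j
    unfolding mult_mat_index[OF WK_c K i j]
    by (intro sum.cong refl) (use that in \<open>simp add: WK del: index_mult_mat\<close>)
  have norm_e: "?W $$ (e k, j) = (if k = j then 1 else 0)" if "k < n" "j < n" for k j
    using that e_less e_inj by (auto simp: fixrows_def inj_on_def)
  have sumW: "(\<Sum>l<N. \<Gamma> h c i l * ?W $$ (l,j)) = (\<Sum>l<N. \<Gamma> h c i l * fixrows n e U l j)"
    if "j < n" for i j using that by (intro sum.cong) auto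
  have W_off: "?W $$ (i,j) = U i j" if "i < N" "j < n" "i \<notin> e ` {..<n}" for i j
    using that by (simp add: fixrows_def)
  have row: "(if i \<in> e ` {..<n} then (?W * ?K) $$ (i,j) else ?W $$ (i,j)) =
        A h c i * (if i \<in> e ` {..<n} then (?W * ?K * ?K) $$ (i,j) else (?W * ?K) $$ (i,j)) +
        (\<Sum>l<N. \<Gamma> h c i l * ?W $$ (l,j))" if i: "i < N" and j: "j < n" for i j
  proof (cases "i \<in> e ` {..<n}")
    case True
    show ?thesis
      by (simp only: True if_True WK[OF i j] WKK[OF i j True] sumW[OF j])
        (rule U[OF i j, unfolded wstep_def])
  next
    case False
    show ?thesis
      by (simp only: False if_False WK[OF i j] W_off[OF i j False] sumW[OF j])
        (rule U[OF i j, unfolded wstep_def])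
  qed
  show ?thesis
    by (rule iffD2[OF whsol_shifted_iff[OF c _ W K]], erule den) (intro conjI allI impI norm_e row)
qed

text \<open>The limit of the iteration for one sufficiently large \<open>c\<close> supplies the
  pair. The last clause concerns the use with \<epsilon> = 0 and constant weight, where the limit is
  non-negative and substochastic.\<close>

lemma whsol_exists:
  assumes eps: "0 < \<epsilon> \<or> \<epsilon> = 0 \<and> (\<forall>i<N. Im (h i) = 0)"
    and d_pos: "\<And>i. i < N \<Longrightarrow> 0 < d i"
    and drift: "\<And>i. i < N \<Longrightarrow> (\<Sum>l<N. q i l * d l) \<le> (Re (h i) - \<epsilon>) * d i"
  shows "\<exists>W G. whsol N n e a v q h W G \<and> in_D n G \<and>
     ((\<forall>i. h i = of_real (Re (h i) - \<epsilon>)) \<and> d = (\<lambda>_. 1) \<longrightarrow> in_G n G \<and> in_H N n W)"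
proof -
  let ?h' = "\<lambda>i. Re (h i) - \<epsilon>"
  obtain c where c: "good h \<epsilon> c"
    using eventually_happens'[OF _ eventually_good[OF eps]] by auto
  have c0: "0 < c" and den: "\<And>i. i < N \<Longrightarrow> D h c i \<noteq> 0" using c by (auto simp: good_def)
  interpret majorised_step N n e "A h c" "\<Gamma> h c" "A ?h' c" "\<Gamma> ?h' c" d
  proof
    show "A ?h' c i * d i + (\<Sum>l<N. \<Gamma> ?h' c i l * d l) \<le> d i" if "i < N" for i
      using weight_iff(1)[OF that] c that drift[OF that] by (simp add: good_def)
  qed (use c e_less e_inj d_pos in \<open>auto simp: good_def\<close>)
  let ?W = "mat N n (\<lambda>(i,j). fixrows n e Xlim i j)" and ?K = "mat n n (\<lambda>(k,j). Xlim (e k) j)"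
  let ?G = "of_real c \<cdot>\<^sub>m (?K - 1\<^sub>m n) :: complex mat"
  have K: "?K \<in> carrier_mat n n" by auto
  have G: "?G \<in> carrier_mat n n" by (rule shifted_carrier[OF K])
  have sol: "whsol N n e a v q h ?W ?G" by (rule whsol_of_fixpoint[OF c0 den Xlim_fixpoint])
  have Krow: "(\<Sum>j<n. norm (?K $$ (k,j)) * d (e j)) \<le> d (e k)" if "k < n" for k
    using Xlim_weight[OF e_less[OF that]] that by simp
  have "Re s \<le> 0" if "eigenvalue ?G s" for s
  proof -
    \<comment> \<open>The disc of radius \<open>c\<close> about \<open>- c\<close>, where
      \<open>s\<close> must lie, is contained in the closed left half plane.\<close>
    have "eigenvalue ?K (s / c + 1)"
      using that c0 eigenvalue_shifted_iff[OF K, of "of_real c" "s / c + 1"] by simp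
    then have "norm (s / c + 1) \<le> 1"
      by (intro eigenvalue_norm_le_1[OF K, of "\<lambda>k. d (e k)"] d_pos e_less Krow) auto
    then have "Re (s / c + 1) \<le> 1" using complex_Re_le_cmod order_trans by blast
    then show ?thesis using c0 by (simp add: divide_le_0_iff)
  qed
  then have inD: "in_D n ?G" unfolding in_D_def using G by blast
  \<comment> \<open>The premise on \<open>h\<close> forces \<epsilon> = 0 and makes \<open>h\<close>
    real, so that the coefficients equal their majorants.\<close>
  have "in_G n ?G \<and> in_H N n ?W" if h: "\<forall>i. h i = of_real (?h' i)" and d: "d = (\<lambda>_. 1)"
  proof -
    have *: "A h c = (\<lambda>i. of_real (A ?h' c i))" "\<Gamma> h c = (\<lambda>i l. of_real (\<Gamma> ?h' c i l))"
      unfolding walpha_of_real[symmetric] wgamma_of_real[symmetric] using h by simp_all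
    note nn = Xlim_nonneg[OF _ _ *]
    have re: "norm (Xlim i j) = Re (Xlim i j)" if "i < N" "j < n" for i j
      using nn[OF that] by (simp add: cmod_eq_Re)
    have rows: "(\<Sum>j<n. Re (Xlim i j)) \<le> 1" if "i < N" for i
      using Xlim_weight[OF that] that by (simp add: d re)
    have G_index: "?G $$ (i,j) = c * (Xlim (e i) j - (if i = j then 1 else 0))" if "i < n" "j < n" for i j
      using that by simp
    have "(\<Sum>j<n. Re (?G $$ (i,j))) \<le> 0" if i: "i < n" for i
    proof -
      have "(\<Sum>j<n. Re (?G $$ (i,j))) = (\<Sum>j<n. c * Re (Xlim (e i) j) - (if j = i then c else 0))"
        by (intro sum.cong refl) (use i in \<open>auto simp: right_diff_distrib\<close>)
      also have "\<dots> = c * ((\<Sum>j<n. Re (Xlim (e i) j)) - 1)"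
        using i by (simp add: sum_subtractf sum_distrib_left right_diff_distrib)
      also have "\<dots> \<le> 0" using rows[OF e_less[OF i]] c0 by (simp add: mult_nonneg_nonpos)
      finally show ?thesis .
    qed
    then have "in_G n ?G"
      unfolding in_G_def using G c0 e_less nn by auto
    moreover have "(\<Sum>j<n. Re (fixrows n e Xlim i j)) \<le> 1" if i: "i < N" for i
    proof (cases "i \<in> e ` {..<n}")
      case True
      then obtain k where k: "k < n" "i = e k" by auto
      have "(\<Sum>j<n. Re (fixrows n e Xlim i j)) = (\<Sum>j<n. if j = k then 1 else 0)"
        using True k e_inj by (intro sum.cong) (auto simp: fixrows_def inj_on_def)
      then show ?thesis using k by simp
    qed (use rows[OF i] in \<open>simp add: fixrows_def\<close>)
    then have "in_H N n ?W"
      unfolding in_H_def using nn by (auto simp: fixrows_def)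
    ultimately show ?thesis by blast
  qed
  then show ?thesis using sol inD by blast
qed

end

subsection \<open>Uniqueness\<close>

text \<open>Every value of \<open>u\<close> is either zero initially or a combination of other
  values with total weighted coefficient below one. The equations look forward in \<open>m\<close>,
  so a bound uniform in \<open>m\<close> is what gets improved: each substitution gains a fixed
  factor, and the bound tends to zero.\<close>

lemma contraction_zero:
  fixes u :: "nat \<Rightarrow> nat \<Rightarrow> complex"
  assumes \<alpha>: "\<And>i. i < N \<Longrightarrow> norm (\<alpha> i) \<le> \<alpha>' i"
    and \<gamma>: "\<And>i l. i < N \<Longrightarrow> l < N \<Longrightarrow> norm (\<gamma> i l) \<le> \<gamma>' i l"
    and d_pos: "\<And>i. i < N \<Longrightarrow> 0 < d i"
    and weight: "\<And>i. i < N \<Longrightarrow> \<alpha>' i * d i + (\<Sum>l<N. \<gamma>' i l * d l) < d i"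
    and bounded: "\<And>m i. i < N \<Longrightarrow> norm (u m i) \<le> b * d i"
    and init: "\<And>i. i < N \<Longrightarrow> i \<in> R \<Longrightarrow> u 0 i = 0"
    and on: "\<And>m i. i < N \<Longrightarrow> i \<in> R \<Longrightarrow> u (Suc m) i = \<alpha> i * u (Suc (Suc m)) i + (\<Sum>l<N. \<gamma> i l * u m l)"
    and off: "\<And>m i. i < N \<Longrightarrow> i \<notin> R \<Longrightarrow> u m i = \<alpha> i * u (Suc m) i + (\<Sum>l<N. \<gamma> i l * u m l)"
    and i: "i < N"
  shows "u m i = 0"
proof -
  let ?f = "\<lambda>i. \<alpha>' i * d i + (\<Sum>l<N. \<gamma>' i l * d l)"
  have "0 < N" using i by linarith
  then obtain j where j: "j < N" "\<And>l. l < N \<Longrightarrow> ?f l / d l \<le> ?f j / d j"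
    using obtain_max_index[of N "\<lambda>l. ?f l / d l"] by blast
  \<comment> \<open>The worst ratio over the finitely many rows; strictness of \<open>weight\<close>
    makes it less than one.\<close>
  define \<theta> where "\<theta> = ?f j / d j"
  have f0: "0 \<le> ?f i" if "i < N" for i
    using that order_trans[OF norm_ge_zero \<alpha>] order_trans[OF norm_ge_zero \<gamma>] d_pos
    by (intro add_nonneg_nonneg sum_nonneg mult_nonneg_nonneg) (auto intro: less_imp_le)
  have \<theta>: "0 \<le> \<theta>" "\<theta> < 1"
    using f0[OF j(1)] weight[OF j(1)] d_pos[OF j(1)] by (simp_all add: \<theta>_def)
  have f\<theta>: "?f i \<le> \<theta> * d i" if "i < N" for i
    using j(2)[OF that] d_pos[OF that] unfolding \<theta>_def[symmetric] by (simp only: pos_divide_le_eq)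
  have "0 \<le> b * d i" using order_trans[OF norm_ge_zero bounded[OF i]] .
  then have b: "0 \<le> b" using d_pos[OF i] by (simp add: zero_le_mult_iff)
  \<comment> \<open>The induction is on the number \<open>k\<close> of substitutions with
    \<open>m\<close> arbitrary, since the right-hand sides involve indices larger than
    \<open>m\<close>.\<close>
  have "norm (u m i) \<le> \<theta> ^ k * (b * d i)" if "i < N" for k m i
    using that
  proof (induction k arbitrary: m i)
    case 0
    then show ?case using bounded by simp
  next
    case (Suc k)
    have step: "norm (\<alpha> i * u m' i + (\<Sum>l<N. \<gamma> i l * u m'' l)) \<le> \<theta> ^ Suc k * (b * d i)" for m' m''
    proof -
      have "norm (\<alpha> i * u m' i) \<le> \<alpha>' i * (\<theta> ^ k * (b * d i))"
        by (intro norm_mult_le \<alpha> Suc)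
      moreover have "norm (\<Sum>l<N. \<gamma> i l * u m'' l) \<le> (\<Sum>l<N. \<gamma>' i l * (\<theta> ^ k * (b * d l)))"
        by (intro sum_norm_le norm_mult_le \<gamma> Suc) auto
      ultimately have "norm (\<alpha> i * u m' i + (\<Sum>l<N. \<gamma> i l * u m'' l)) \<le>
          \<alpha>' i * (\<theta> ^ k * (b * d i)) + (\<Sum>l<N. \<gamma>' i l * (\<theta> ^ k * (b * d l)))"
        by (rule norm_triangle_le[OF add_mono])
      also have "\<dots> = (\<theta> ^ k * b) * ?f i"
        by (simp add: ring_distribs sum_distrib_left mult_ac)
      also have "\<dots> \<le> (\<theta> ^ k * b) * (\<theta> * d i)"
        using f\<theta>[OF Suc.prems] \<theta> b by (intro mult_left_mono) auto
      finally show ?thesis by (simp add: mult_ac)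
    qed
    show ?case
    proof (cases "i \<in> R")
      case True
      show ?thesis
      proof (cases m)
        case 0
        have "0 \<le> \<theta> ^ Suc k * (b * d i)"
          using \<theta> b d_pos[OF Suc.prems] by (intro mult_nonneg_nonneg) auto
        then show ?thesis using init[OF Suc.prems True] 0 by simp
      next
        case (Suc m0)
        show ?thesis unfolding Suc on[OF Suc.prems True, of m0] by (rule step)
      qed
    next
      case False
      then show ?thesis using step[of "Suc m" m] off[OF Suc.prems False, of m] by simp
    qed
  qed
  then have "norm (u m i) \<le> \<theta> ^ k * (b * d i)" for k using i by blast
  moreover have "(\<lambda>k. \<theta> ^ k * (b * d i)) \<longlonglongrightarrow> 0 * (b * d i)"
    using \<theta> by (intro tendsto_mult tendsto_const LIMSEQ_realpow_zero)
  ultimately have "norm (u m i) \<le> 0 * (b * d i)"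
    by (intro LIMSEQ_le_const[where a = "norm (u m i)"]) auto
  then show ?thesis by simp
qed

text \<open>Powers unfold on the right by definition; the left form lets the first factors join
  \<open>W\<close>, so that the row equations apply to \<open>W K\<close> and
  \<open>W K K\<close>.\<close>

lemma pow_mat_Suc_left:
  assumes K: "K \<in> carrier_mat n n" shows "K ^\<^sub>m Suc m = K * K ^\<^sub>m m"
proof (induction m)
  case 0
  then show ?case using K by simp
next
  case (Suc m)
  have P: "K ^\<^sub>m m \<in> carrier_mat n n" using K by simp
  have "K ^\<^sub>m Suc (Suc m) = (K * K ^\<^sub>m m) * K" using Suc by simp
  also have "\<dots> = K * K ^\<^sub>m Suc m" by (simp add: assoc_mult_mat[OF K P K])
  finally show ?case .
qed

text \<open>The squared modulus is \<open>1 + 2 Re s / c + |s|^2 / c^2\<close>, and for large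
  \<open>c\<close> the negative linear term wins.\<close>

lemma eventually_stable:
  fixes s :: complex
  assumes "Re s < 0" shows "\<forall>\<^sub>F c in at_top. norm (1 + s / of_real c) < 1"
  using eventually_gt_at_top[of 0] eventually_gt_at_top[of "(norm s)\<^sup>2 / (- 2 * Re s)"]
proof eventually_elim
  case (elim c)
  have "(norm s)\<^sup>2 < c * (- 2 * Re s)" using iffD1[OF pos_divide_less_eq elim(2)] assms by simp
  then have *: "(norm s)\<^sup>2 / c\<^sup>2 < - 2 * Re s / c"
    using elim(1) by (simp add: divide_simps power2_eq_square mult_ac)
  have "(norm (1 + s / of_real c))\<^sup>2 = 1 + 2 * Re s / c + ((Re s)\<^sup>2 + (Im s)\<^sup>2) / c\<^sup>2"
    using elim(1) unfolding cmod_power2 by (simp add: power2_sum power_divide add_divide_distrib)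
  also have "\<dots> < 1\<^sup>2" using * unfolding cmod_power2 by simp
  finally show ?case by (rule power2_less_imp_less) simp
qed

text \<open>The spectrum is finite, so one large \<open>c\<close> moves all eigenvalues of
  \<open>K = I + G / c\<close> strictly inside the unit disc. A spectral radius below one bounds the
  powers by way of the Jordan normal form.\<close>

lemma eventually_powers_bounded:
  assumes G: "G \<in> carrier_mat n n" and n: "0 < n" and ev: "\<And>s. eigenvalue G s \<Longrightarrow> Re s < 0"
  shows "\<forall>\<^sub>F c in at_top. \<exists>K \<in> carrier_mat n n. \<exists>b. G = of_real c \<cdot>\<^sub>m (K - 1\<^sub>m n) \<and> (\<forall>m. norm_bound (K ^\<^sub>m m) b)"
proof -
  have "\<forall>\<^sub>F c in at_top. \<forall>s\<in>spectrum G. norm (1 + s / of_real c) < 1"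
    using card_finite_spectrum[OF G] ev
    by (intro eventually_ball_finite ballI eventually_stable) (auto simp: spectrum_def)
  then show ?thesis
    using eventually_gt_at_top[of 0]
  proof eventually_elim
    case (elim c)
    let ?K = "1\<^sub>m n + of_real (1 / c) \<cdot>\<^sub>m G"
    have K: "?K \<in> carrier_mat n n" using G by simp
    have GK: "G = of_real c \<cdot>\<^sub>m (?K - 1\<^sub>m n)"
      using G elim(2) by (intro eq_matI) auto
    obtain \<kappa> where \<kappa>: "eigenvalue ?K \<kappa>" "spectral_radius ?K = norm \<kappa>"
      using spectral_radius_mem_max(1)[OF K n] by (auto simp: spectrum_def)
    have "eigenvalue G (of_real c * (\<kappa> - 1))"
      using \<kappa>(1) eigenvalue_shifted_iff[OF K, of "of_real c" \<kappa>] elim(2) GK by simp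
    then have "norm (1 + of_real c * (\<kappa> - 1) / of_real c) < 1"
      using elim(1) by (auto simp: spectrum_def)
    then have "norm \<kappa> < 1" using elim(2) by simp
    then have "\<exists>b. \<forall>m. norm_bound (?K ^\<^sub>m m) b"
      using spectral_radius_jnf_norm_bound_less_1_upper_triangular[OF K] \<kappa>(2) by simp
    then show ?case using K GK by blast
  qed
qed

lemma norm_mult_pow_bounded:
  fixes W K :: "complex mat"
  assumes W: "W \<in> carrier_mat N n" and K: "K \<in> carrier_mat n n" and b: "\<And>m. norm_bound (K ^\<^sub>m m) b"
    and i: "i < N" and j: "j < n"
  shows "norm ((W * K ^\<^sub>m m) $$ (i,j)) \<le> (\<Sum>k<n. norm (W $$ (i,k)) * b)"
proof -
  have P: "K ^\<^sub>m m \<in> carrier_mat n n" using K by simp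
  have "norm ((K ^\<^sub>m m) $$ (k,j)) \<le> b" if "k < n" for k
    using b[of m, unfolded norm_bound_def carrier_matD[OF P]] that j by blast
  then show ?thesis unfolding mult_mat_index[OF W P i j]
    by (intro sum_norm_le norm_mult_le) auto
qed

context wh_system
begin

text \<open>The solved row equation multiplied on the right by \<open>K ^\<^sub>m m\<close>. It is
  linear in the sequence of powers, hence inherited by differences of two solutions.\<close>

lemma whsol_pow_rows:
  assumes c: "0 < c" and den: "\<And>i. i < N \<Longrightarrow> D h c i \<noteq> 0"
    and K: "K \<in> carrier_mat n n"
    and sol: "whsol N n e a v q h W (of_real c \<cdot>\<^sub>m (K - 1\<^sub>m n))"
    and i: "i < N" and j: "j < n"
  defines "X \<equiv> \<lambda>m i. (W * K ^\<^sub>m m) $$ (i,j)"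
  shows "(if i \<in> e ` {..<n} then X (Suc m) i else X m i) =
    A h c i * (if i \<in> e ` {..<n} then X (Suc (Suc m)) i else X (Suc m) i) + (\<Sum>l<N. \<Gamma> h c i l * X m l)"
proof -
  have W: "W \<in> carrier_mat N n" using sol by (simp add: whsol_def)
  have WK: "W * K \<in> carrier_mat N n" and WKK: "W * K * K \<in> carrier_mat N n" using W K by auto
  let ?P = "K ^\<^sub>m m"
  have P: "?P \<in> carrier_mat n n" using K by simp
  have S1: "W * K ^\<^sub>m Suc m = W * K * ?P"
    unfolding pow_mat_Suc_left[OF K] by (rule assoc_mult_mat[OF W K P, symmetric])
  have S2: "W * K ^\<^sub>m Suc (Suc m) = W * K * K * ?P"
    unfolding pow_mat_Suc_left[OF K, of "Suc m"] unfolding pow_mat_Suc_left[OF K]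
    using assoc_mult_mat[OF W K mult_carrier_mat[OF K P]] assoc_mult_mat[OF WK K P] by simp
  have X: "X m l = (\<Sum>k<n. W $$ (l,k) * ?P $$ (k,j))" "X (Suc m) l = (\<Sum>k<n. (W * K) $$ (l,k) * ?P $$ (k,j))"
    "X (Suc (Suc m)) l = (\<Sum>k<n. (W * K * K) $$ (l,k) * ?P $$ (k,j))" if "l < N" for l
    unfolding X_def S1 S2
    using mult_mat_index[OF W P that j] mult_mat_index[OF WK P that j] mult_mat_index[OF WKK P that j]
    by blast+
  let ?Z = "\<lambda>k. if i \<in> e ` {..<n} then (W * K) $$ (i,k) else W $$ (i,k)"
  let ?Z' = "\<lambda>k. if i \<in> e ` {..<n} then (W * K * K) $$ (i,k) else (W * K) $$ (i,k)"
  have row: "?Z k = A h c i * ?Z' k + (\<Sum>l<N. \<Gamma> h c i l * W $$ (l,k))" if "k < n" for k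
    using iffD1[OF whsol_shifted_iff[OF c _ W K] sol] den i that by blast
  have "(if i \<in> e ` {..<n} then X (Suc m) i else X m i) = (\<Sum>k<n. ?Z k * ?P $$ (k,j))"
    using X[OF i] by simp
  also have "\<dots> = (\<Sum>k<n. (A h c i * ?Z' k + (\<Sum>l<N. \<Gamma> h c i l * W $$ (l,k))) * ?P $$ (k,j))"
    by (intro sum.cong refl) (simp only: row lessThan_iff)
  also have "\<dots> = A h c i * (\<Sum>k<n. ?Z' k * ?P $$ (k,j)) + (\<Sum>k<n. \<Sum>l<N. \<Gamma> h c i l * (W $$ (l,k) * ?P $$ (k,j)))"
    by (simp only: distrib_right sum.distrib sum_distrib_left sum_distrib_right mult.assoc)
  also have "(\<Sum>k<n. \<Sum>l<N. \<Gamma> h c i l * (W $$ (l,k) * ?P $$ (k,j))) = (\<Sum>l<N. \<Gamma> h c i l * X m l)"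
    by (subst sum.swap) (simp add: X(1) sum_distrib_left)
  also have "(\<Sum>k<n. ?Z' k * ?P $$ (k,j)) = (if i \<in> e ` {..<n} then X (Suc (Suc m)) i else X (Suc m) i)"
    using X[OF i] by simp
  finally show ?thesis .
qed

text \<open>Given \<open>G x = s x\<close>, the vector \<open>W x\<close> solves the row equation
  with the number \<open>s\<close> in place of \<open>G\<close>. For imaginary \<open>s\<close> the
  \<open>a\<close> and \<open>v\<close> terms cannot weaken the diagonal, which contradicts strict
  dominance at the weighted maximum.\<close>

lemma whsol_eigenvalue_stable:
  assumes d_pos: "\<And>i. i < N \<Longrightarrow> 0 < d i"
    and drift: "\<And>i. i < N \<Longrightarrow> (\<Sum>l<N. q i l * d l) < Re (h i) * d i"
    and sol: "whsol N n e a v q h W G" and inD: "in_D n G" and ev: "eigenvalue G s"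
  shows "Re s < 0"
proof (rule ccontr)
  assume "\<not> Re s < 0"
  then have s0: "Re s = 0" using inD ev by (force simp: in_D_def)
  have W: "W \<in> carrier_mat N n" and G: "G \<in> carrier_mat n n"
    and We: "\<And>k j. k < n \<Longrightarrow> j < n \<Longrightarrow> W $$ (e k, j) = (if k = j then 1 else 0)"
    using sol by (auto simp: whsol_def)
  have GG: "G * G \<in> carrier_mat n n" and WG: "W * G \<in> carrier_mat N n" using W G by auto
  obtain x k where x: "x \<in> carrier_vec n" "k < n" "x $ k \<noteq> 0" "G *\<^sub>v x = s \<cdot>\<^sub>v x"
    using eigenvalueE[OF ev G] by metis
  define w where "w = (\<lambda>i. \<Sum>j<n. W $$ (i,j) * x $ j)"
  have w: "w i = (W *\<^sub>v x) $ i" if "i < N" for i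
    using mult_mat_vec_index[OF W x(1) that] by (simp add: w_def)
  \<comment> \<open>The normalisation of \<open>W\<close> guarantees that \<open>W x\<close> is not
    zero.\<close>
  have "w (e k) = (\<Sum>j<n. if j = k then x $ k else 0)"
    unfolding w_def using x(2) We by (intro sum.cong) auto
  then have wk: "w (e k) \<noteq> 0" using x by simp
  have WGx: "W * G *\<^sub>v x = s \<cdot>\<^sub>v (W *\<^sub>v x)"
    using assoc_mult_mat_vec[OF W G x(1)] x(1,4) mult_mat_vec[OF W x(1)] by simp
  have "W * (G * G) *\<^sub>v x = W * G *\<^sub>v (G *\<^sub>v x)"
    using assoc_mult_mat[OF W G G] assoc_mult_mat_vec[OF WG G x(1)] by simp
  also have "\<dots> = s \<cdot>\<^sub>v (s \<cdot>\<^sub>v (W *\<^sub>v x))"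
    unfolding x(4) mult_mat_vec[OF WG x(1)] WGx ..
  finally have WGGx: "W * (G * G) *\<^sub>v x = s \<cdot>\<^sub>v (s \<cdot>\<^sub>v (W *\<^sub>v x))" .
  have eqn: "of_real (a i) * (s * (s * w i)) - of_real (v i) * (s * w i)
      + (\<Sum>l<N. of_real (q i l) * w l) - h i * w i = 0" if i: "i < N" for i
  proof -
    have 1: "s * w i = (\<Sum>j<n. (W * G) $$ (i,j) * x $ j)"
      using arg_cong[OF WGx, of "\<lambda>y. y $ i"] mult_mat_vec_index[OF WG x(1) i] i w W by simp
    have 2: "s * (s * w i) = (\<Sum>j<n. (W * (G * G)) $$ (i,j) * x $ j)"
      using arg_cong[OF WGGx, of "\<lambda>y. y $ i"] mult_mat_vec_index[OF mult_carrier_mat[OF W GG] x(1) i] i w W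
      by simp
    have 3: "(\<Sum>l<N. of_real (q i l) * w l) = (\<Sum>j<n. (\<Sum>l<N. of_real (q i l) * W $$ (l,j)) * x $ j)"
      unfolding w_def sum_distrib_left sum_distrib_right by (subst sum.swap) (simp add: mult.assoc)
    have "of_real (a i) * (s * (s * w i)) - of_real (v i) * (s * w i)
      + (\<Sum>l<N. of_real (q i l) * w l) - h i * w i =
      (\<Sum>j<n. (of_real (a i) * (W * (G * G)) $$ (i,j) - of_real (v i) * (W * G) $$ (i,j)
        + (\<Sum>l<N. of_real (q i l) * W $$ (l,j)) - h i * W $$ (i,j)) * x $ j)"
      unfolding 2 unfolding 1 3
      by (simp only: w_def left_diff_distrib distrib_right sum.distrib sum_subtractf sum_distrib_left mult.assoc)
    also have "\<dots> = 0"
      using sol i by (intro sum.neutral) (simp add: whsol_def del: index_mult_mat)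
    finally show ?thesis .
  qed
  obtain i t where i: "i < N" "0 < t" "norm (w i) = t * d i" "\<And>l. l < N \<Longrightarrow> norm (w l) \<le> t * d l"
    using obtain_weighted_max[of N d "e k" w] d_pos e_less[OF x(2)] wk by metis
  let ?c = "of_real (a i) * (s * s) - of_real (v i) * s + of_real (q i i) - h i"
  let ?R = "{..<N} - {i}"
  have split: "sum f {..<N} = f i + sum f ?R" for f :: "nat \<Rightarrow> 'b::comm_monoid_add"
    using i(1) by (simp add: sum.remove)
  have "?c * w i = - (\<Sum>l\<in>?R. of_real (q i l) * w l)"
    using eqn[OF i(1)] unfolding split by (simp add: algebra_simps)
  then have "norm ?c * (t * d i) = norm (\<Sum>l\<in>?R. of_real (q i l) * w l)"
    by (metis i(3) norm_minus_cancel norm_mult)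
  also have "\<dots> \<le> (\<Sum>l\<in>?R. q i l * (t * d l))"
    using q_nonneg[OF i(1)] i(4) by (intro sum_norm_le norm_mult_le) auto
  also have "\<dots> = t * (\<Sum>l\<in>?R. q i l * d l)" by (simp add: sum_distrib_left mult_ac)
  finally have le: "t * (norm ?c * d i) \<le> t * (\<Sum>l\<in>?R. q i l * d l)" by (simp add: mult_ac)
  then have le: "norm ?c * d i \<le> (\<Sum>l\<in>?R. q i l * d l)" using i(2) by simp
  \<comment> \<open>On the imaginary axis \<open>a i * s^2\<close> is real and at most zero, while
    \<open>v i * s\<close> has no real part.\<close>
  have "Re ?c = - (a i * (Im s)\<^sup>2) + q i i - Re (h i)" using s0 by (simp add: power2_eq_square)
  moreover have "- Re ?c \<le> norm ?c" using abs_Re_le_cmod[of ?c] by linarith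
  moreover have "0 \<le> a i * (Im s)\<^sup>2" using a_nonneg[OF i(1)] by simp
  ultimately have "Re (h i) - q i i \<le> norm ?c" by linarith
  then have "(Re (h i) - q i i) * d i \<le> norm ?c * d i" using d_pos[OF i(1)] by (intro mult_right_mono) auto
  then show False using le drift[OF i(1)] unfolding split by (simp add: left_diff_distrib)
qed

text \<open>Finitely many strict inequalities have a least gap; half of it keeps them
  strict.\<close>

lemma obtain_slack:
  assumes d_pos: "\<And>i. i < N \<Longrightarrow> 0 < d i"
    and drift: "\<And>i. i < N \<Longrightarrow> (\<Sum>l<N. q i l * d l) < Re (h i) * d i"
  obtains \<epsilon> where "0 < \<epsilon>" "\<And>i. i < N \<Longrightarrow> (\<Sum>l<N. q i l * d l) < (Re (h i) - \<epsilon>) * d i"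
proof -
  define f where "f = (\<lambda>i. (\<Sum>l<N. q i l * d l) / d i - Re (h i))"
  have f: "(\<Sum>l<N. q i l * d l) / d i = f i + Re (h i)" for i by (simp add: f_def)
  obtain k where k: "k < N" "\<And>i. i < N \<Longrightarrow> f i \<le> f k"
    using obtain_max_index[OF N_pos, of f] by blast
  have fk: "f k < 0" using drift[OF k(1)] d_pos[OF k(1)] by (simp add: f_def pos_divide_less_eq)
  have "(\<Sum>l<N. q i l * d l) < (Re (h i) - (- f k / 2)) * d i" if "i < N" for i
  proof -
    have "(\<Sum>l<N. q i l * d l) / d i < Re (h i) - (- f k / 2)"
      unfolding f using k(2)[OF that] fk by linarith
    then show ?thesis using d_pos[OF that] by (simp only: pos_divide_less_eq)
  qed
  then show ?thesis using that[of "- f k / 2"] fk by simp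
qed

text \<open>The sequences \<open>W K^m\<close> and \<open>W' K'^m\<close> satisfy the same linear
  recurrence and agree initially on the normalised rows, so \<open>contraction_zero\<close> makes
  them equal. Exponent 0 then gives the equality of \<open>W\<close>, exponent 1 that of
  \<open>K\<close>.\<close>

lemma whsol_unique:
  assumes d_pos: "\<And>i. i < N \<Longrightarrow> 0 < d i"
    and drift: "\<And>i. i < N \<Longrightarrow> (\<Sum>l<N. q i l * d l) < Re (h i) * d i"
    and sol: "whsol N n e a v q h W G" "in_D n G"
    and sol': "whsol N n e a v q h W' G'" "in_D n G'"
  shows "W = W'" "G = G'"
proof -
  obtain \<epsilon> where eps: "0 < \<epsilon>" "\<And>i. i < N \<Longrightarrow> (\<Sum>l<N. q i l * d l) < (Re (h i) - \<epsilon>) * d i"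
    using obtain_slack[of d h, OF d_pos drift] by blast
  let ?h' = "\<lambda>i. Re (h i) - \<epsilon>"
  have W: "W \<in> carrier_mat N n" "W' \<in> carrier_mat N n" and G: "G \<in> carrier_mat n n" "G' \<in> carrier_mat n n"
    and We: "\<And>k j. k < n \<Longrightarrow> j < n \<Longrightarrow> W $$ (e k, j) = (if k = j then 1 else 0)"
      "\<And>k j. k < n \<Longrightarrow> j < n \<Longrightarrow> W' $$ (e k, j) = (if k = j then 1 else 0)"
    using sol(1) sol'(1) by (auto simp: whsol_def)
  \<comment> \<open>The comparison requires a single \<open>c\<close> for both solutions; each
    requirement holds for all large \<open>c\<close>.\<close>
  have "\<forall>\<^sub>F c in at_top. good h \<epsilon> c \<and>
     (\<exists>K \<in> carrier_mat n n. \<exists>b. G = of_real c \<cdot>\<^sub>m (K - 1\<^sub>m n) \<and> (\<forall>m. norm_bound (K ^\<^sub>m m) b)) \<and>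
     (\<exists>K \<in> carrier_mat n n. \<exists>b. G' = of_real c \<cdot>\<^sub>m (K - 1\<^sub>m n) \<and> (\<forall>m. norm_bound (K ^\<^sub>m m) b))"
    using eps(1)
    by (intro eventually_conj eventually_good eventually_powers_bounded G n_pos
        whsol_eigenvalue_stable[OF d_pos drift sol] whsol_eigenvalue_stable[OF d_pos drift sol']) auto
  then obtain c where c: "good h \<epsilon> c"
     "\<exists>K \<in> carrier_mat n n. \<exists>b. G = of_real c \<cdot>\<^sub>m (K - 1\<^sub>m n) \<and> (\<forall>m. norm_bound (K ^\<^sub>m m) b)"
     "\<exists>K \<in> carrier_mat n n. \<exists>b. G' = of_real c \<cdot>\<^sub>m (K - 1\<^sub>m n) \<and> (\<forall>m. norm_bound (K ^\<^sub>m m) b)"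
    using eventually_happens'[OF trivial_limit_at_top_linorder] by blast
  then obtain K b K' b' where K: "K \<in> carrier_mat n n" "G = of_real c \<cdot>\<^sub>m (K - 1\<^sub>m n)" "\<And>m. norm_bound (K ^\<^sub>m m) b"
    and K': "K' \<in> carrier_mat n n" "G' = of_real c \<cdot>\<^sub>m (K' - 1\<^sub>m n)" "\<And>m. norm_bound (K' ^\<^sub>m m) b'"
    by blast
  have c0: "0 < c" and den: "\<And>i. i < N \<Longrightarrow> D h c i \<noteq> 0" using c(1) by (auto simp: good_def)
  have zero: "(W * K ^\<^sub>m m) $$ (i,j) = (W' * K' ^\<^sub>m m) $$ (i,j)" if i: "i < N" and j: "j < n" for m i j
  proof -
    define u where "u = (\<lambda>m i. (W * K ^\<^sub>m m) $$ (i,j) - (W' * K' ^\<^sub>m m) $$ (i,j))"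
    have rows: "(if i \<in> e ` {..<n} then u (Suc m) i else u m i) =
      A h c i * (if i \<in> e ` {..<n} then u (Suc (Suc m)) i else u (Suc m) i) + (\<Sum>l<N. \<Gamma> h c i l * u m l)"
      if "i < N" for i m
      using whsol_pow_rows[OF c0 den K(1) sol(1)[unfolded K(2)] that j, of m]
        whsol_pow_rows[OF c0 den K'(1) sol'(1)[unfolded K'(2)] that j, of m]
      unfolding u_def
      by (cases "i \<in> e ` {..<n}")
        (simp_all only: if_True if_False right_diff_distrib sum_subtractf add_diff_add)
    define C where "C = (\<lambda>i. (\<Sum>k<n. norm (W $$ (i,k)) * b) + (\<Sum>k<n. norm (W' $$ (i,k)) * b'))"
    have uC: "norm (u m i) \<le> C i" if "i < N" for m i
      unfolding u_def C_def
      using norm_mult_pow_bounded[OF W(1) K(1,3) that j, of m] norm_mult_pow_bounded[OF W(2) K'(1,3) that j, of m]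
      by (rule norm_triangle_le_diff[OF add_mono])
    \<comment> \<open>Summing the ratios \<open>C l / d l\<close> is a crude way to get one constant
      for all rows; only its independence of \<open>m\<close> and \<open>i\<close> matters.\<close>
    have bounded: "norm (u m i) \<le> (\<Sum>l<N. C l / d l) * d i" if "i < N" for m i
    proof -
      have "C l / d l \<ge> 0" if "l < N" for l
        using order_trans[OF norm_ge_zero uC[OF that]] d_pos[OF that] by simp
      then have "C i / d i \<le> (\<Sum>l<N. C l / d l)" using that by (intro member_le_sum) auto
      then have "C i \<le> (\<Sum>l<N. C l / d l) * d i" using d_pos[OF that] by (simp only: pos_divide_le_eq)
      then show ?thesis using uC[OF that, of m] by linarith
    qed
    have "u m i = 0"
    proof (rule contraction_zero[where \<alpha> = "A h c" and \<gamma> = "\<Gamma> h c" and \<alpha>' = "A ?h' c" and \<gamma>' = "\<Gamma> ?h' c"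
          and R = "e ` {..<n}" and N = N and d = d])
      show "A ?h' c i * d i + (\<Sum>l<N. \<Gamma> ?h' c i l * d l) < d i" if "i < N" for i
        using weight_iff(2)[OF that] c(1) that eps(2)[OF that] by (simp add: good_def)
      show "u 0 i = 0" if "i < N" "i \<in> e ` {..<n}" for i
        using that We j W by (auto simp: u_def right_mult_one_mat[OF W(1)] right_mult_one_mat[OF W(2)]
            carrier_matD[OF K(1)] carrier_matD[OF K'(1)] simp del: index_mult_mat)
      show "u (Suc m) i = A h c i * u (Suc (Suc m)) i + (\<Sum>l<N. \<Gamma> h c i l * u m l)"
        if "i < N" "i \<in> e ` {..<n}" for m i using rows[OF that(1), of m] by (simp only: that if_True)
      show "u m i = A h c i * u (Suc m) i + (\<Sum>l<N. \<Gamma> h c i l * u m l)"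
        if "i < N" "i \<notin> e ` {..<n}" for m i using rows[OF that(1), of m] by (simp only: that if_False)
    qed (use c(1) d_pos bounded i in \<open>auto simp: good_def\<close>)
    then show ?thesis by (simp add: u_def)
  qed
  show WW: "W = W'"
  proof (rule eq_matI)
    fix i j assume "i < dim_row W'" "j < dim_col W'"
    then show "W $$ (i,j) = W' $$ (i,j)"
      using zero[of i j 0] W K(1) K'(1) by (simp add: right_mult_one_mat[OF W(1)] right_mult_one_mat[OF W(2)] del: index_mult_mat)
  qed (use W in auto)
  \<comment> \<open>Row \<open>e k\<close> of \<open>W K\<close> is row \<open>k\<close> of
    \<open>K\<close>.\<close>
  have "K = K'"
  proof (rule eq_matI)
    fix k j assume "k < dim_row K'" "j < dim_col K'"
    then have k: "k < n" and j: "j < n" using K' by auto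
    have row: "(V * L) $$ (e k, j) = L $$ (k,j)"
      if V: "V \<in> carrier_mat N n" and L: "L \<in> carrier_mat n n"
        and Ve: "\<And>k j. k < n \<Longrightarrow> j < n \<Longrightarrow> V $$ (e k, j) = (if k = j then 1 else 0)" for V L :: "complex mat"
    proof -
      have "(V * L) $$ (e k, j) = (\<Sum>m<n. if m = k then L $$ (k,j) else 0)"
        unfolding mult_mat_index[OF V L e_less[OF k] j] using k by (intro sum.cong) (auto simp: Ve)
      then show ?thesis using k by simp
    qed
    have "K ^\<^sub>m 1 = K" "K' ^\<^sub>m 1 = K'" using K(1) K'(1) by simp_all
    then show "K $$ (k,j) = K' $$ (k,j)"
      using zero[OF e_less[OF k] j, of 1] row[OF W(1) K(1) We(1)] row[OF W(2) K'(1) We(2)] by simp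
  qed (use K K' in auto)
  then show "G = G'" using K(2) K'(2) by simp
qed

end

section \<open>Existence, uniqueness and the real case together\<close>

context wh_system
begin

text \<open>Existence is invoked twice for real \<open>h\<close>: with slack and weight
  \<open>d\<close>, and without slack and with weight one. Uniqueness identifies the two solutions,
  so the signs and row sums of the second belong to the first.\<close>

lemma whsol_ex1:
  assumes d_pos: "\<And>i. i < N \<Longrightarrow> 0 < d i"
    and drift: "\<And>i. i < N \<Longrightarrow> (\<Sum>l<N. q i l * d l) < Re (h i) * d i"
    and rows: "\<And>i. i < N \<Longrightarrow> (\<Sum>l<N. q i l) \<le> 0"
    and h: "\<And>i. i < N \<Longrightarrow> 0 \<le> Re (h i)"
  shows "\<exists>W G. whsol N n e a v q h W G \<and> in_D n G \<and>
    (\<forall>W' G'. whsol N n e a v q h W' G' \<and> in_D n G' \<longrightarrow> W' = W \<and> G' = G) \<and>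
    ((\<forall>i<N. Im (h i) = 0) \<longrightarrow> in_G n G \<and> in_H N n W)"
proof -
  obtain \<epsilon> where eps: "0 < \<epsilon>" "\<And>i. i < N \<Longrightarrow> (\<Sum>l<N. q i l * d l) < (Re (h i) - \<epsilon>) * d i"
    using obtain_slack[of d h, OF d_pos drift] by blast
  obtain W G where WG: "whsol N n e a v q h W G" "in_D n G"
    using whsol_exists[of \<epsilon> h d] eps d_pos less_imp_le by blast
  have uniq: "W' = W \<and> G' = G" if "whsol N n e a v q h W' G'" "in_D n G'" for W' G'
    using whsol_unique[OF d_pos drift that WG] by blast
  have "in_G n G \<and> in_H N n W" if im: "\<forall>i<N. Im (h i) = 0"
  proof -
    \<comment> \<open>\<open>h\<close> is known to be real only on the states, whereas
      \<open>whsol_exists\<close> asks for it at every index; values outside the states do not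
      affect \<open>whsol\<close>.\<close>
    let ?h = "\<lambda>i. complex_of_real (Re (h i))"
    have cong: "whsol N n e a v q ?h = whsol N n e a v q h"
      by (intro ext whsol_cong) (use im in \<open>auto simp: complex_eq_iff\<close>)
    have "\<exists>W G. whsol N n e a v q ?h W G \<and> in_D n G \<and>
      ((\<forall>i. ?h i = of_real (Re (?h i) - 0)) \<and> (\<lambda>_ :: nat. 1 :: real) = (\<lambda>_. 1) \<longrightarrow> in_G n G \<and> in_H N n W)"
      by (rule whsol_exists[of 0 ?h "\<lambda>_. 1"]) (use rows h in \<open>auto intro: order_trans\<close>)
    then show ?thesis using uniq by (auto simp: cong)
  qed
  then show ?thesis using WG uniq by blast
qed

end

text \<open>The constant one has drift at most zero, and adding a small multiple of \<open>w\<close>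
  makes it strictly negative where \<open>r\<close> vanishes. Where \<open>r\<close> is positive
  there is room for any drift that is small enough.\<close>

lemma obtain_drift_weight:
  fixes q :: "nat \<Rightarrow> nat \<Rightarrow> real" and r w :: "nat \<Rightarrow> real"
  assumes rows: "\<And>i. i < N \<Longrightarrow> (\<Sum>l<N. q i l) \<le> 0"
    and w: "\<And>i. i < N \<Longrightarrow> 0 \<le> w i"
    and r: "\<And>i. i < N \<Longrightarrow> 0 \<le> r i"
    and drift: "\<And>i. i < N \<Longrightarrow> r i = 0 \<Longrightarrow> (\<Sum>l<N. q i l * w l) < 0"
  obtains d where "\<And>i. i < N \<Longrightarrow> 0 < d i" "\<And>i. i < N \<Longrightarrow> (\<Sum>l<N. q i l * d l) < r i * d i"
proof -
  have "\<forall>\<^sub>F \<delta> in at_right 0. \<forall>i\<in>{..<N}. \<delta> * (\<Sum>l<N. q i l * w l) < r i"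
  proof (intro eventually_ball_finite ballI)
    fix i assume "i \<in> {..<N}"
    then have i: "i < N" by simp
    show "\<forall>\<^sub>F \<delta> in at_right 0. \<delta> * (\<Sum>l<N. q i l * w l) < r i"
    proof (cases "r i = 0")
      case True
      show ?thesis using eventually_at_right_less[of 0]
        by eventually_elim (use drift[OF i True] True in \<open>simp add: mult_pos_neg\<close>)
    next
      case False
      have "((\<lambda>\<delta>. \<delta> * (\<Sum>l<N. q i l * w l)) \<longlongrightarrow> 0 * (\<Sum>l<N. q i l * w l)) (at_right 0)"
        by (intro tendsto_mult tendsto_ident_at tendsto_const)
      then show ?thesis using r[OF i] False by (intro order_tendstoD(2)) auto
    qed
  qed simp
  then have "\<forall>\<^sub>F \<delta> in at_right (0::real). 0 < \<delta> \<and> (\<forall>i\<in>{..<N}. \<delta> * (\<Sum>l<N. q i l * w l) < r i)"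
    using eventually_at_right_less[of 0] by (rule eventually_conj[rotated])
  then obtain \<delta> :: real where \<delta>: "0 < \<delta>" "\<And>i. i < N \<Longrightarrow> \<delta> * (\<Sum>l<N. q i l * w l) < r i"
    using eventually_happens'[OF trivial_limit_at_right_real] by blast
  show ?thesis
  proof (rule that[of "\<lambda>i. 1 + \<delta> * w i"])
    show "0 < 1 + \<delta> * w i" if "i < N" for i using w[OF that] \<delta>(1) by (intro add_pos_nonneg) auto
    show "(\<Sum>l<N. q i l * (1 + \<delta> * w l)) < r i * (1 + \<delta> * w i)" if i: "i < N" for i
    proof -
      have "(\<Sum>l<N. q i l * (1 + \<delta> * w l)) = (\<Sum>l<N. q i l) + \<delta> * (\<Sum>l<N. q i l * w l)"
        by (simp add: algebra_simps sum.distrib sum_distrib_left)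
      moreover have "0 \<le> r i * (\<delta> * w i)" using r[OF i] w[OF i] \<delta>(1) by simp
      ultimately show ?thesis using rows[OF i] \<delta>(2)[OF i] by (simp add: distrib_left)
    qed
  qed
qed

subsection \<open>Block matrices\<close>

lemma mtot_0: "mtot 0 m = 0" and mtot_Suc: "mtot (Suc k) m = mtot k m + m k"
  by (simp_all add: mtot_def)

text \<open>With one row or column per regime the block offset is the regime index itself; this
  brings \<open>bblock\<close> and \<open>Ablock\<close> under the lemmas on block diagonal
  matrices.\<close>

lemma mtot_one: "mtot k (\<lambda>_. Suc 0) = k"
  by (simp add: mtot_def)

lemma mtot_mono: "i \<le> k \<Longrightarrow> mtot i m \<le> mtot k m"
  unfolding mtot_def by (intro sum_mono2) auto

lemma mtot_offset_less: "i < k \<Longrightarrow> j < m i \<Longrightarrow> mtot i m + j < mtot k m"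
  using mtot_mono[of "Suc i" k m] by (simp add: mtot_Suc)

lemma mtot_decompose:
  "t < mtot k m \<Longrightarrow> \<exists>i<k. \<exists>j<m i. t = mtot i m + j"
proof (induction k)
  case (Suc k)
  show ?case
  proof (cases "t < mtot k m")
    case True
    then show ?thesis using Suc.IH less_SucI by blast
  next
    case False
    then have "t - mtot k m < m k" "t = mtot k m + (t - mtot k m)"
      using Suc.prems by (auto simp: mtot_Suc)
    then show ?thesis by blast
  qed
qed (simp add: mtot_0)

text \<open>Assembles functions given on the separate blocks into one function of the flat
  index.\<close>

lemma mtot_glue:
  "\<exists>w. \<forall>i<k. \<forall>j<m i. w (mtot i m + j) = f i j"
proof (induction k)
  case (Suc k)
  then obtain w where w: "\<forall>i<k. \<forall>j<m i. w (mtot i m + j) = f i j" by blast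
  show ?case
  proof (intro exI[of _ "\<lambda>t. if t < mtot k m then w t else f k (t - mtot k m)"] allI impI)
    fix i j assume ij: "i < Suc k" "j < m i"
    show "(if mtot i m + j < mtot k m then w (mtot i m + j) else f k (mtot i m + j - mtot k m)) = f i j"
      using ij w mtot_offset_less[of i k j m] by (cases "i = k") auto
  qed
qed simp

lemma sum_lessThan_add:
  "(\<Sum>l<m + k. f l) = (\<Sum>l<m. f l) + (\<Sum>l<k. f (m + l))" for f :: "nat \<Rightarrow> 'a::comm_monoid_add"
  by (induction k) (simp_all add: add.assoc)

text \<open>Indexing by the number of blocks permits induction by appending the last block.\<close>

definition diagm :: "(nat \<Rightarrow> real mat) \<Rightarrow> nat \<Rightarrow> real mat" where
  "diagm f k = diag_block_mat (map f [0..<k])"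

lemma diagm_carrier:
  assumes "\<And>i. i < k \<Longrightarrow> f i \<in> carrier_mat (r i) (c i)"
  shows "diagm f k \<in> carrier_mat (mtot k r) (mtot k c)"
  using assms
proof (induction k)
  case (Suc k)
  then have "diagm f k \<in> carrier_mat (mtot k r) (mtot k c)" "f k \<in> carrier_mat (r k) (c k)" by auto
  then show ?case by (auto simp: diagm_def diag_block_mat_last Let_def mtot_Suc)
qed (auto simp: diagm_def mtot_0)

lemma diagm_index:
  assumes "\<And>i. i < k \<Longrightarrow> f i \<in> carrier_mat (r i) (c i)" "i < k" "\<rho> < r i" "j < mtot k c"
  shows "diagm f k $$ (mtot i r + \<rho>, j) =
    (if mtot i c \<le> j \<and> j < mtot i c + c i then f i $$ (\<rho>, j - mtot i c) else 0)"
  using assms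
proof (induction k)
  case (Suc k)
  have D: "diagm f k \<in> carrier_mat (mtot k r) (mtot k c)" using Suc.prems by (intro diagm_carrier) auto
  have fk: "f k \<in> carrier_mat (r k) (c k)" using Suc.prems by auto
  have eq: "diagm f (Suc k) = four_block_mat (diagm f k) (0\<^sub>m (mtot k r) (c k)) (0\<^sub>m (r k) (mtot k c)) (f k)"
    using D fk by (simp add: diagm_def diag_block_mat_last Let_def)
  have j: "j < mtot k c + c k" using Suc.prems by (simp add: mtot_Suc)
  show ?case
  proof (cases "i = k")
    case True
    then show ?thesis using Suc.prems(3) j D fk by (auto simp: eq)
  next
    case False
    then have i: "i < k" using Suc.prems by simp
    have le: "mtot i r + \<rho> < mtot k r" by (rule mtot_offset_less[of i k _ r]) (use i Suc.prems in auto)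
    have "mtot i c + c i \<le> mtot k c" using mtot_mono[of "Suc i" k c] i by (simp add: mtot_Suc)
    moreover have "diagm f k $$ (mtot i r + \<rho>, j) =
        (if mtot i c \<le> j \<and> j < mtot i c + c i then f i $$ (\<rho>, j - mtot i c) else 0)"
      if "j < mtot k c"
      using Suc.IH[OF _ i Suc.prems(3) that] Suc.prems(1) by simp
    ultimately show ?thesis
      using le j carrier_matD[OF D] carrier_matD[OF fk] unfolding eq by (cases "j < mtot k c") auto
  qed
qed simp

text \<open>A row meets non-zero entries only in its own block, so statements about the large blocks
  reduce to one regime.\<close>

lemma diagm_row_sum:
  assumes f: "\<And>i. i < k \<Longrightarrow> f i \<in> carrier_mat (r i) (c i)" and i: "i < k" "\<rho> < r i"
  shows "(\<Sum>j<mtot k c. diagm f k $$ (mtot i r + \<rho>, j) * x j) =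
    (\<Sum>j<c i. f i $$ (\<rho>, j) * x (mtot i c + j))"
proof -
  have le: "mtot i c + c i \<le> mtot k c" using mtot_mono[of "Suc i" k c] i by (simp add: mtot_Suc)
  let ?g = "\<lambda>j. f i $$ (\<rho>, j - mtot i c) * x j"
  have index: "diagm f k $$ (mtot i r + \<rho>, j) =
      (if mtot i c \<le> j \<and> j < mtot i c + c i then f i $$ (\<rho>, j - mtot i c) else 0)"
    if "j < mtot k c" for j
    using diagm_index[of k f r c i \<rho> j] f i that by blast
  have "(\<Sum>j<mtot k c. diagm f k $$ (mtot i r + \<rho>, j) * x j) =
      (\<Sum>j<mtot k c. if mtot i c \<le> j \<and> j < mtot i c + c i then ?g j else 0)"
    by (intro sum.cong refl) (simp add: index)
  also have "\<dots> = (\<Sum>j = mtot i c..<mtot i c + c i. ?g j)"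
    by (rule sum.mono_neutral_cong_right) (use le in auto)
  also have "\<dots> = (\<Sum>j<c i. f i $$ (\<rho>, j) * x (mtot i c + j))"
    by (simp add: sum.atLeastLessThan_shift_0[of _ "mtot i c"] atLeast0LessThan)
  finally show ?thesis .
qed

text \<open>The function is the mean absorption time \<open>- B^{-1} 1\<close> of the phase process,
  available because \<open>B\<close> is invertible. Its non-negativity is a minimum
  principle.\<close>

lemma subgen_hitting_time:
  assumes B: "subgen_real m B" "invertible_mat B"
  obtains w where "\<And>k. k < m \<Longrightarrow> 0 \<le> w k" "\<And>k. k < m \<Longrightarrow> (\<Sum>j<m. B $$ (k,j) * w j) = -1"
proof -
  have Bc: "B \<in> carrier_mat m m" using B by (simp add: subgen_real_def)
  obtain C' where C': "C' * B = 1\<^sub>m (dim_row C')" "B * C' = 1\<^sub>m m"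
    using B(2) Bc unfolding invertible_mat_def inverts_mat_def by auto
  have "dim_row C' = m" using arg_cong[OF C'(1), of dim_col] Bc by simp
  moreover have "dim_col C' = m" using arg_cong[OF C'(2), of dim_col] by simp
  ultimately have Cc: "C' \<in> carrier_mat m m" by auto
  define w where "w = (\<lambda>k. - (\<Sum>l<m. C' $$ (k,l)))"
  have eq: "(\<Sum>j<m. B $$ (k,j) * w j) = -1" if k: "k < m" for k
  proof -
    have "(\<Sum>j<m. B $$ (k,j) * w j) = - (\<Sum>l<m. \<Sum>j<m. B $$ (k,j) * C' $$ (j,l))"
      by (subst sum.swap) (simp add: w_def sum_negf sum_distrib_left)
    also have "\<dots> = - (\<Sum>l<m. if l = k then 1 else 0)"
    proof (intro arg_cong[of _ _ uminus] sum.cong refl)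
      fix l assume l: "l \<in> {..<m}"
      then show "(\<Sum>j<m. B $$ (k,j) * C' $$ (j,l)) = (if l = k then 1 else 0)"
        using mult_mat_index[OF Bc Cc k, of l, symmetric] C'(2) k by simp
    qed
    finally show ?thesis using k by simp
  qed
  text \<open>At a minimum of \<open>w\<close> with a negative value, \<open>B w\<close> would be non-negative.\<close>
  have "0 \<le> w k" if k: "k < m" for k
  proof (rule ccontr)
    assume neg: "\<not> 0 \<le> w k"
    have "0 < m" using k by linarith
    then obtain i where i: "i < m" "\<And>l. l < m \<Longrightarrow> - w l \<le> - w i"
      using obtain_max_index[of m "\<lambda>l. - w l"] by blast
    have wi: "w i < 0" using i(2)[OF k] neg by linarith
    have "(\<Sum>j<m. B $$ (i,j) * w i) \<le> (\<Sum>j<m. B $$ (i,j) * w j)"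
    proof (intro sum_mono)
      fix j assume "j \<in> {..<m}"
      then have j: "j < m" by simp
      show "B $$ (i,j) * w i \<le> B $$ (i,j) * w j"
        using B(1) i(1) j i(2)[OF j]
        by (cases "i = j") (auto simp: subgen_real_def intro!: mult_left_mono)
    qed
    moreover have "0 \<le> (\<Sum>j<m. B $$ (i,j)) * w i"
      using B(1) i(1) wi by (intro mult_nonpos_nonpos) (auto simp: subgen_real_def)
    ultimately show False using eq[OF i(1)] by (simp add: sum_distrib_right)
  qed
  then show ?thesis using that eq by blast
qed

section \<open>Generator blocks of one jump direction\<close>

locale ph_blocks =
  fixes N0 :: nat and m :: "nat \<Rightarrow> nat" and beta :: "nat \<Rightarrow> real vec" and B :: "nat \<Rightarrow> real mat"
    and l :: "nat \<Rightarrow> real"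
  assumes ph: "i < N0 \<Longrightarrow> ph_params (m i) (beta i) (B i)" and l_nonneg: "i < N0 \<Longrightarrow> 0 \<le> l i"
begin

lemma B_carrier: "i < N0 \<Longrightarrow> B i \<in> carrier_mat (m i) (m i)"
  using ph by (auto simp: ph_params_def subgen_real_def)

lemma Bblock_diagm: "Bblock N0 B = diagm B N0"
  by (simp add: Bblock_def diagm_def)

lemma bblock_diagm:
  "bblock N0 m B = diagm (\<lambda>i. mat (m i) 1 (\<lambda>(r,_). - (\<Sum>c<m i. B i $$ (r,c)))) N0"
  by (simp add: bblock_def diagm_def)

lemma Ablock_diagm:
  "Ablock N0 m l beta = diagm (\<lambda>i. mat 1 (m i) (\<lambda>(_,c). l i * beta i $ c)) N0"
  by (simp add: Ablock_def diagm_def)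

lemma Bblock_carrier: "Bblock N0 B \<in> carrier_mat (mtot N0 m) (mtot N0 m)"
  unfolding Bblock_diagm by (intro diagm_carrier B_carrier)

lemma bblock_carrier: "bblock N0 m B \<in> carrier_mat (mtot N0 m) N0"
  unfolding bblock_diagm by (subst (2) mtot_one[symmetric], intro diagm_carrier) auto

lemma Ablock_carrier: "Ablock N0 m l beta \<in> carrier_mat N0 (mtot N0 m)"
  unfolding Ablock_diagm by (subst (2) mtot_one[symmetric], intro diagm_carrier) auto

lemma Bblock_off_diag:
  assumes "r < mtot N0 m" "s < mtot N0 m" "r \<noteq> s"
  shows "0 \<le> Bblock N0 B $$ (r,s)"
proof -
  obtain i \<rho> where i: "i < N0" "\<rho> < m i" "r = mtot i m + \<rho>" using mtot_decompose[OF assms(1)] by blast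
  show ?thesis
    unfolding Bblock_diagm i(3)
    using diagm_index[of N0 B m m i \<rho> s, OF B_carrier i(1,2) assms(2)] ph[OF i(1)] i assms(3)
    by (auto simp: ph_params_def subgen_real_def)
qed

lemma bblock_nonneg:
  assumes "r < mtot N0 m" "s < N0" shows "0 \<le> bblock N0 m B $$ (r,s)"
proof -
  let ?f = "\<lambda>i. mat (m i) 1 (\<lambda>(r,_). - (\<Sum>c<m i. B i $$ (r,c)))"
  obtain i \<rho> where i: "i < N0" "\<rho> < m i" "r = mtot i m + \<rho>" using mtot_decompose[OF assms(1)] by blast
  have s: "s < mtot N0 (\<lambda>_. 1)" using assms(2) by (simp add: mtot_one)
  show ?thesis
    unfolding bblock_diagm i(3)
    using diagm_index[of N0 ?f m "\<lambda>_. 1" i \<rho> s] i s ph[OF i(1)]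
    by (auto simp: ph_params_def subgen_real_def)
qed

lemma Ablock_nonneg:
  assumes "r < N0" "s < mtot N0 m" shows "0 \<le> Ablock N0 m l beta $$ (r,s)"
proof -
  let ?f = "\<lambda>i. mat 1 (m i) (\<lambda>(_,c). l i * beta i $ c)"
  show ?thesis
    unfolding Ablock_diagm
    using diagm_index[of N0 ?f "\<lambda>_. 1" m r 0 s] assms ph[OF assms(1)] l_nonneg[OF assms(1)]
    by (auto simp: ph_params_def mtot_one)
qed

lemma Bblock_bblock_row_sum:
  assumes "r < mtot N0 m"
  shows "(\<Sum>s<mtot N0 m. Bblock N0 B $$ (r,s)) + (\<Sum>s<N0. bblock N0 m B $$ (r,s)) = 0"
proof -
  let ?f = "\<lambda>i. mat (m i) 1 (\<lambda>(r,_). - (\<Sum>c<m i. B i $$ (r,c)))"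
  obtain i \<rho> where i: "i < N0" "\<rho> < m i" "r = mtot i m + \<rho>" using mtot_decompose[OF assms] by blast
  show ?thesis
    unfolding Bblock_diagm bblock_diagm i(3)
    using diagm_row_sum[of N0 B m m i \<rho> "\<lambda>_. 1"] diagm_row_sum[of N0 ?f m "\<lambda>_. 1" i \<rho> "\<lambda>_. 1"] i B_carrier
    by (simp add: mtot_one)
qed

lemma Ablock_row_sum:
  assumes "r < N0" shows "(\<Sum>s<mtot N0 m. Ablock N0 m l beta $$ (r,s)) = l r"
proof -
  let ?f = "\<lambda>i. mat 1 (m i) (\<lambda>(_,c). l i * beta i $ c)"
  show ?thesis
    unfolding Ablock_diagm
    using diagm_row_sum[of N0 ?f "\<lambda>_. 1" m r 0 "\<lambda>_. 1"] assms ph[OF assms]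
    by (simp add: mtot_one ph_params_def sum_distrib_left[symmetric])
qed

text \<open>The absorption times of the individual regimes, glued along the block offsets.\<close>

lemma Bblock_hitting_time:
  obtains w where "\<And>r. r < mtot N0 m \<Longrightarrow> 0 \<le> w r"
    "\<And>r. r < mtot N0 m \<Longrightarrow> (\<Sum>s<mtot N0 m. Bblock N0 B $$ (r,s) * w s) = -1"
proof -
  have "\<exists>w. (\<forall>k<m i. 0 \<le> w k) \<and> (\<forall>k<m i. (\<Sum>j<m i. B i $$ (k,j) * w j) = -1)" if "i < N0" for i
    using ph[OF that] subgen_hitting_time[of "m i" "B i"] unfolding ph_params_def by metis
  then obtain u where u: "\<And>i k. i < N0 \<Longrightarrow> k < m i \<Longrightarrow> 0 \<le> u i k"
    "\<And>i k. i < N0 \<Longrightarrow> k < m i \<Longrightarrow> (\<Sum>j<m i. B i $$ (k,j) * u i j) = -1"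
    by metis
  obtain w where w: "\<forall>i<N0. \<forall>j<m i. w (mtot i m + j) = u i j" using mtot_glue by blast
  show ?thesis
  proof (rule that[of w])
    fix r assume "r < mtot N0 m"
    then obtain i \<rho> where i: "i < N0" "\<rho> < m i" "r = mtot i m + \<rho>" using mtot_decompose by blast
    show "0 \<le> w r" using i w u by simp
    show "(\<Sum>s<mtot N0 m. Bblock N0 B $$ (r,s) * w s) = -1"
      unfolding Bblock_diagm i(3) using diagm_row_sum[of N0 B m m i \<rho> w, OF B_carrier i(1,2)] i w u(2) by simp
  qed
qed

end

subsection \<open>The regime-switching model\<close>

lemma block3_index:
  assumes "M11 \<in> carrier_mat a a" "M12 \<in> carrier_mat a b" "M13 \<in> carrier_mat a c"
    "M21 \<in> carrier_mat b a" "M22 \<in> carrier_mat b b" "M23 \<in> carrier_mat b c"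
    "M31 \<in> carrier_mat c a" "M32 \<in> carrier_mat c b" "M33 \<in> carrier_mat c c"
  shows "block3 M11 M12 M13 M21 M22 M23 M31 M32 M33 \<in> carrier_mat (a + b + c) (a + b + c)"
    and "i < a + b + c \<Longrightarrow> j < a + b + c \<Longrightarrow> block3 M11 M12 M13 M21 M22 M23 M31 M32 M33 $$ (i,j) =
    (if i < a then if j < a then M11 $$ (i,j) else if j < a + b then M12 $$ (i,j - a) else M13 $$ (i,j - (a + b))
     else if i < a + b then if j < a then M21 $$ (i - a,j) else if j < a + b then M22 $$ (i - a,j - a)
       else M23 $$ (i - a,j - (a + b))
     else if j < a then M31 $$ (i - (a + b),j) else if j < a + b then M32 $$ (i - (a + b),j - a)
       else M33 $$ (i - (a + b),j - (a + b)))"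
  using assms by (auto simp: block3_def hstack_def vstack_def carrier_matD[OF assms(1)]
      carrier_matD[OF assms(5)] carrier_matD[OF assms(9)])

lemma sum_lessThan_3:
  fixes f x y z :: "nat \<Rightarrow> 'a::comm_monoid_add"
  assumes "\<And>j. j < a \<Longrightarrow> f j = x j" "\<And>j. j < b \<Longrightarrow> f (a + j) = y j" "\<And>j. j < c \<Longrightarrow> f (a + b + j) = z j"
  shows "(\<Sum>j<a + b + c. f j) = (\<Sum>j<a. x j) + (\<Sum>j<b. y j) + (\<Sum>j<c. z j)"
  unfolding sum_lessThan_add by (simp add: assms add.assoc[symmetric])

section \<open>The matrix equations entry by entry\<close>

lemma dmat_carrier: "dmat N f \<in> carrier_mat N N"
  by (simp add: dmat_def)

lemma map_mat_dmat: "map_mat of_real (dmat N f) = dmat N (\<lambda>i. of_real (f i))"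
  by (intro eq_matI) (auto simp: dmat_def)

lemma dmat_mult_index:
  fixes X :: "complex mat"
  assumes X: "X \<in> carrier_mat N n" and i: "i < N" and j: "j < n"
  shows "(dmat N f * X) $$ (i,j) = f i * X $$ (i,j)"
proof -
  have "(dmat N f * X) $$ (i,j) = (\<Sum>k<N. if k = i then f i * X $$ (i,j) else 0)"
    unfolding mult_mat_index[OF dmat_carrier X i j]
    using i by (intro sum.cong) (auto simp: dmat_def)
  then show ?thesis using i by simp
qed

text \<open>Left multiplication by a diagonal matrix scales rows. The plus sign in the second
  equation is expressed as a reversed drift, so that both equations take the shape of
  \<open>whsol\<close>.\<close>

lemma WH_equation_iff:
  fixes W G :: "complex mat" and Q0 :: "real mat" and s v :: "nat \<Rightarrow> real" and h :: "nat \<Rightarrow> complex"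
  assumes W: "W \<in> carrier_mat N n" and G: "G \<in> carrier_mat n n" and Q0: "Q0 \<in> carrier_mat N N"
  defines "S \<equiv> dmat N (\<lambda>i. complex_of_real (s i))" and "V \<equiv> dmat N (\<lambda>i. complex_of_real (v i))"
    and "Qh \<equiv> map_mat complex_of_real Q0 - dmat N h"
  shows "(1/2) \<cdot>\<^sub>m (S * S * W * (G * G)) - V * W * G + Qh * W = 0\<^sub>m N n \<longleftrightarrow>
    (\<forall>i<N. \<forall>j<n. of_real ((s i)\<^sup>2 / 2) * (W * (G * G)) $$ (i,j) - of_real (v i) * (W * G) $$ (i,j)
        + (\<Sum>l<N. of_real (Q0 $$ (i,l)) * W $$ (l,j)) - h i * W $$ (i,j) = 0)" (is ?minus)
    and "(1/2) \<cdot>\<^sub>m (S * S * W * (G * G)) + V * W * G + Qh * W = 0\<^sub>m N n \<longleftrightarrow>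
    (\<forall>i<N. \<forall>j<n. of_real ((s i)\<^sup>2 / 2) * (W * (G * G)) $$ (i,j) - of_real (- v i) * (W * G) $$ (i,j)
        + (\<Sum>l<N. of_real (Q0 $$ (i,l)) * W $$ (l,j)) - h i * W $$ (i,j) = 0)" (is ?plus)
proof -
  have S: "S \<in> carrier_mat N N" and V: "V \<in> carrier_mat N N" and Qh: "Qh \<in> carrier_mat N N"
    using Q0 by (auto simp: S_def V_def Qh_def dmat_def)
  have GG: "G * G \<in> carrier_mat n n" and WG: "W * G \<in> carrier_mat N n" using W G by auto
  have WGG: "W * (G * G) \<in> carrier_mat N n" and SW: "S * W \<in> carrier_mat N n" using S W GG by auto
  have SWGG: "S * (W * (G * G)) \<in> carrier_mat N n" using S WGG by auto
  have "S * S * W * (G * G) = S * (S * (W * (G * G)))"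
    using assoc_mult_mat[OF S S W] assoc_mult_mat[OF S SW GG] assoc_mult_mat[OF S W GG] by simp
  then have 1: "(S * S * W * (G * G)) $$ (i,j) = of_real ((s i)\<^sup>2) * (W * (G * G)) $$ (i,j)"
    if "i < N" "j < n" for i j
    using dmat_mult_index[OF SWGG that, of "\<lambda>i. complex_of_real (s i)"]
      dmat_mult_index[OF WGG that, of "\<lambda>i. complex_of_real (s i)"]
    by (simp only: S_def power2_eq_square of_real_mult mult.assoc)
  have 2: "(V * W * G) $$ (i,j) = of_real (v i) * (W * G) $$ (i,j)" if "i < N" "j < n" for i j
    unfolding V_def assoc_mult_mat[OF dmat_carrier W G] by (rule dmat_mult_index[OF WG that])
  have 3: "(Qh * W) $$ (i,j) = (\<Sum>l<N. of_real (Q0 $$ (i,l)) * W $$ (l,j)) - h i * W $$ (i,j)"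
    if i: "i < N" and j: "j < n" for i j
  proof -
    have "(Qh * W) $$ (i,j) = (\<Sum>l<N. of_real (Q0 $$ (i,l)) * W $$ (l,j) - (if l = i then h i * W $$ (i,j) else 0))"
      unfolding mult_mat_index[OF Qh W i j]
      using i Q0 by (intro sum.cong) (auto simp: Qh_def dmat_def left_diff_distrib)
    then show ?thesis using i by (simp add: sum_subtractf)
  qed
  have c: "S * S * W * (G * G) \<in> carrier_mat N n" "V * W * G \<in> carrier_mat N n" "Qh * W \<in> carrier_mat N n"
    using S V Qh W G GG by auto
  have eq0: "X = 0\<^sub>m N n \<longleftrightarrow> (\<forall>i<N. \<forall>j<n. X $$ (i,j) = 0)" if "X \<in> carrier_mat N n" for X :: "complex mat"
    using that by (auto intro!: eq_matI)
  have lin: "(k \<cdot>\<^sub>m X - Y + Z) $$ (i,j) = k * X $$ (i,j) - Y $$ (i,j) + Z $$ (i,j)"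
      "(k \<cdot>\<^sub>m X + Y + Z) $$ (i,j) = k * X $$ (i,j) + Y $$ (i,j) + Z $$ (i,j)"
    if "X \<in> carrier_mat N n" "Y \<in> carrier_mat N n" "Z \<in> carrier_mat N n" "i < N" "j < n"
    for X Y Z :: "complex mat" and k i j
    using that by auto
  have m: "((1/2) \<cdot>\<^sub>m (S * S * W * (G * G)) - V * W * G + Qh * W) $$ (i,j) =
      (1/2) * (S * S * W * (G * G)) $$ (i,j) - (V * W * G) $$ (i,j) + (Qh * W) $$ (i,j)"
    and p: "((1/2) \<cdot>\<^sub>m (S * S * W * (G * G)) + V * W * G + Qh * W) $$ (i,j) =
      (1/2) * (S * S * W * (G * G)) $$ (i,j) + (V * W * G) $$ (i,j) + (Qh * W) $$ (i,j)"
    if "i < N" "j < n" for i j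
    using lin[OF c that] by blast+
  have "(1/2) \<cdot>\<^sub>m (S * S * W * (G * G)) - V * W * G + Qh * W \<in> carrier_mat N n"
    "(1/2) \<cdot>\<^sub>m (S * S * W * (G * G)) + V * W * G + Qh * W \<in> carrier_mat N n"
    using c by (auto intro!: add_carrier_mat)
  note eqs = this[THEN eq0]
  show ?minus unfolding eqs(1)
    by (intro all_cong1 imp_cong refl) (simp only: m 1 2 3, simp add: add_diff_eq)
  show ?plus unfolding eqs(2)
    by (intro all_cong1 imp_cong refl) (simp only: p 1 2 3, simp add: add_diff_eq)
qed

text \<open>The two halves share no unknown, hence the factorisation splits into independent
  problems: one with the first \<open>Np\<close> rows normalised, one with the last
  \<open>Nm\<close> rows.\<close>

lemma is_mat_WH_iff:
  fixes Q0 :: "real mat"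
  assumes Q0: "Q0 \<in> carrier_mat N N"
  shows "is_mat_WH (map_mat complex_of_real (dmat N s)) (map_mat complex_of_real (dmat N v))
      (map_mat complex_of_real Q0 - dmat N h) Np Nm Wp Gp Wm Gm \<longleftrightarrow>
    (whsol N Np (\<lambda>k. k) (\<lambda>i. (s i)\<^sup>2 / 2) v (\<lambda>i l. Q0 $$ (i,l)) h Wp Gp \<and> in_D Np Gp) \<and>
    (whsol N Nm (\<lambda>k. N - Nm + k) (\<lambda>i. (s i)\<^sup>2 / 2) (\<lambda>i. - v i) (\<lambda>i l. Q0 $$ (i,l)) h Wm Gm \<and> in_D Nm Gm)"
proof -
  have dim: "dim_row (map_mat complex_of_real Q0 - dmat N h) = N" by (simp add: dmat_def)
  have "Gp \<in> carrier_mat Np Np" if "in_D Np Gp" using that by (simp add: in_D_def)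
  moreover have "Gm \<in> carrier_mat Nm Nm" if "in_D Nm Gm" using that by (simp add: in_D_def)
  ultimately show ?thesis
    unfolding is_mat_WH_def Let_def dim map_mat_dmat whsol_def
    using WH_equation_iff(1)[OF _ _ Q0, of Wp Np Gp s v h] WH_equation_iff(2)[OF _ _ Q0, of Wm Nm Gm s v h]
    by blast
qed

lemma in_H_vstack_top:
  assumes "in_H (n + k) n W" and "\<And>i j. i < n \<Longrightarrow> j < n \<Longrightarrow> W $$ (i,j) = (if i = j then 1 else 0)"
  shows "\<exists>L. in_H k n L \<and> W = vstack (1\<^sub>m n) L"
proof (intro exI[of _ "mat k n (\<lambda>(i,j). W $$ (n + i, j))"] conjI)
  show "in_H k n (mat k n (\<lambda>(i,j). W $$ (n + i, j)))"
    using assms(1) by (auto simp: in_H_def)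
  show "W = vstack (1\<^sub>m n) (mat k n (\<lambda>(i,j). W $$ (n + i, j)))"
    using assms by (intro eq_matI) (auto simp: in_H_def vstack_def)
qed

lemma in_H_vstack_bottom:
  assumes "in_H (k + n) n W" and "\<And>i j. i < n \<Longrightarrow> j < n \<Longrightarrow> W $$ (k + i,j) = (if i = j then 1 else 0)"
  shows "\<exists>L. in_H k n L \<and> W = vstack L (1\<^sub>m n)"
proof (intro exI[of _ "mat k n (\<lambda>(i,j). W $$ (i, j))"] conjI)
  show "in_H k n (mat k n (\<lambda>(i,j). W $$ (i, j)))"
    using assms(1) by (auto simp: in_H_def)
  have "W $$ (i,j) = (if i - k = j then 1 else 0)" if "\<not> i < k" "i < k + n" "j < n" for i j
    using assms(2)[of "i - k" j] that by simp
  then show "W = vstack (mat k n (\<lambda>(i,j). W $$ (i, j))) (1\<^sub>m n)"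
    using assms(1) by (intro eq_matI) (auto simp: in_H_def vstack_def)
qed

section \<open>The full generator and the two instances\<close>

locale regime_model =
  fixes N0 :: nat and Q :: "real mat" and mu sigma lam p :: "nat \<Rightarrow> real" and mp mm :: "nat \<Rightarrow> nat"
    and betap betam :: "nat \<Rightarrow> real vec" and Bp Bm :: "nat \<Rightarrow> real mat"
  assumes N0_pos: "0 < N0"
    and Q_generator: "generator_real N0 Q"
    and sigma_pos: "i < N0 \<Longrightarrow> 0 < sigma i"
    and lam_nonneg: "i < N0 \<Longrightarrow> 0 \<le> lam i"
    and p_prob: "i < N0 \<Longrightarrow> 0 \<le> p i \<and> p i \<le> 1"
    and ph_up: "i < N0 \<Longrightarrow> ph_params (mp i) (betap i) (Bp i)"
    and ph_down: "i < N0 \<Longrightarrow> ph_params (mm i) (betam i) (Bm i)"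
begin

abbreviation "np \<equiv> mtot N0 mp"
abbreviation "nm \<equiv> mtot N0 mm"
abbreviation "N \<equiv> np + N0 + nm"
abbreviation "Q0 \<equiv> Q0_mat N0 Q lam p mp betap Bp mm betam Bm"
abbreviation "S \<equiv> Sigma_mat N0 sigma mp mm"
abbreviation "V \<equiv> V_mat N0 mu mp mm"

definition "s i = (if np \<le> i \<and> i < np + N0 then sigma (i - np) else 0)"
definition "v i = (if i < np then 1 else if i < np + N0 then mu (i - np) else -1)"

sublocale up: ph_blocks N0 mp betap Bp "\<lambda>i. lam i * p i"
  by unfold_locales (use ph_up lam_nonneg p_prob in auto)

sublocale down: ph_blocks N0 mm betam Bm "\<lambda>i. lam i * (1 - p i)"
  by unfold_locales (use ph_down lam_nonneg p_prob in auto)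

lemma S_dmat: "S = dmat N s"
proof -
  note S3 = block3_index[where a = np and b = N0 and c = nm, OF zero_carrier_mat zero_carrier_mat
      zero_carrier_mat zero_carrier_mat dmat_carrier[of N0 sigma] zero_carrier_mat zero_carrier_mat
      zero_carrier_mat zero_carrier_mat, folded Sigma_mat_def]
  show ?thesis
  proof (rule eq_matI)
    fix i j assume "i < dim_row (dmat N s)" "j < dim_col (dmat N s)"
    then have ij: "i < N" "j < N" by (simp_all add: dmat_def)
    show "S $$ (i,j) = dmat N s $$ (i,j)"
      unfolding S3(2)[OF ij] using ij by (auto simp: dmat_def s_def)
  qed (simp_all add: carrier_matD[OF S3(1)] dmat_def)
qed

lemma V_dmat: "V = dmat N v"
proof -
  note V3 = block3_index[where a = np and b = N0 and c = nm, OF one_carrier_mat zero_carrier_mat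
      zero_carrier_mat zero_carrier_mat dmat_carrier[of N0 mu] zero_carrier_mat zero_carrier_mat
      zero_carrier_mat uminus_carrier_mat[OF one_carrier_mat], folded V_mat_def]
  show ?thesis
  proof (rule eq_matI)
    fix i j assume "i < dim_row (dmat N v)" "j < dim_col (dmat N v)"
    then have ij: "i < N" "j < N" by (simp_all add: dmat_def)
    show "V $$ (i,j) = dmat N v $$ (i,j)"
      unfolding V3(2)[OF ij] using ij by (auto simp: dmat_def v_def)
  qed (simp_all add: carrier_matD[OF V3(1)] dmat_def)
qed

lemma S_dim: "dim_row S = N"
  by (simp add: S_dmat dmat_def)

lemma S_diag: "i < N \<Longrightarrow> S $$ (i,i) = s i" and V_diag: "i < N \<Longrightarrow> V $$ (i,i) = v i"
  by (simp_all add: S_dmat V_dmat dmat_def)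

text \<open>Positivity of \<open>sigma\<close> makes the regime block exactly the diffusive part, so
  the three classes of states are consecutive intervals.\<close>

lemma s_eq_0_iff: "s i = 0 \<longleftrightarrow> \<not> (np \<le> i \<and> i < np + N0)"
proof -
  have "sigma (i - np) \<noteq> 0" if "np \<le> i" "i < np + N0"
    using sigma_pos[of "i - np"] that by (simp add: less_diff_conv2)
  then show ?thesis by (auto simp: s_def)
qed

lemma E0_set_eq: "E0_set S = {np..<np + N0}"
  by (auto simp: E0_set_def S_dim S_diag s_eq_0_iff)

lemma Eplus_set_eq: "Eplus_set S V = {..<np}"
  by (auto simp: Eplus_set_def S_dim S_diag V_diag s_eq_0_iff v_def split: if_splits)

lemma Eminus_set_eq: "Eminus_set S V = {np + N0..<N}"
  by (auto simp: Eminus_set_def S_dim S_diag V_diag s_eq_0_iff v_def split: if_splits)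

lemma Q_carrier: "Q - dmat N0 lam \<in> carrier_mat N0 N0"
  by (simp add: dmat_def minus_carrier_mat)

lemmas Q0_block3_index = block3_index[OF up.Bblock_carrier up.bblock_carrier zero_carrier_mat
    up.Ablock_carrier Q_carrier down.Ablock_carrier zero_carrier_mat down.bblock_carrier down.Bblock_carrier,
    folded Q0_mat_def]

lemma Q0_row_sum:
  "i < np \<Longrightarrow> (\<Sum>j<N. Q0 $$ (i,j) * x j) =
     (\<Sum>j<np. Bblock N0 Bp $$ (i,j) * x j) + (\<Sum>j<N0. bblock N0 mp Bp $$ (i,j) * x (np + j))"
  "i < N0 \<Longrightarrow> (\<Sum>j<N. Q0 $$ (np + i,j) * x j) =
     (\<Sum>j<np. Ablock N0 mp (\<lambda>i. lam i * p i) betap $$ (i,j) * x j)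
     + (\<Sum>j<N0. (Q - dmat N0 lam) $$ (i,j) * x (np + j))
     + (\<Sum>j<nm. Ablock N0 mm (\<lambda>i. lam i * (1 - p i)) betam $$ (i,j) * x (np + N0 + j))"
  "i < nm \<Longrightarrow> (\<Sum>j<N. Q0 $$ (np + N0 + i,j) * x j) =
     (\<Sum>j<N0. bblock N0 mm Bm $$ (i,j) * x (np + j))
     + (\<Sum>j<nm. Bblock N0 Bm $$ (i,j) * x (np + N0 + j))"
proof -
  assume i: "i < np"
  have "(\<Sum>j<N. Q0 $$ (i,j) * x j) =
     (\<Sum>j<np. Bblock N0 Bp $$ (i,j) * x j) + (\<Sum>j<N0. bblock N0 mp Bp $$ (i,j) * x (np + j)) + (\<Sum>j<nm. 0)"
    by (intro sum_lessThan_3) (use i in \<open>simp_all add: Q0_block3_index(2)\<close>)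
  then show "(\<Sum>j<N. Q0 $$ (i,j) * x j) =
     (\<Sum>j<np. Bblock N0 Bp $$ (i,j) * x j) + (\<Sum>j<N0. bblock N0 mp Bp $$ (i,j) * x (np + j))"
    by simp
next
  assume i: "i < N0"
  show "(\<Sum>j<N. Q0 $$ (np + i,j) * x j) =
     (\<Sum>j<np. Ablock N0 mp (\<lambda>i. lam i * p i) betap $$ (i,j) * x j)
     + (\<Sum>j<N0. (Q - dmat N0 lam) $$ (i,j) * x (np + j))
     + (\<Sum>j<nm. Ablock N0 mm (\<lambda>i. lam i * (1 - p i)) betam $$ (i,j) * x (np + N0 + j))"
    by (intro sum_lessThan_3) (use i in \<open>simp_all add: Q0_block3_index(2) del: index_minus_mat\<close>)
next
  assume i: "i < nm"
  have "(\<Sum>j<N. Q0 $$ (np + N0 + i,j) * x j) = (\<Sum>j<np. 0) +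
     (\<Sum>j<N0. bblock N0 mm Bm $$ (i,j) * x (np + j))
     + (\<Sum>j<nm. Bblock N0 Bm $$ (i,j) * x (np + N0 + j))"
    by (intro sum_lessThan_3) (use i in \<open>simp_all add: Q0_block3_index(2)\<close>)
  then show "(\<Sum>j<N. Q0 $$ (np + N0 + i,j) * x j) =
     (\<Sum>j<N0. bblock N0 mm Bm $$ (i,j) * x (np + j))
     + (\<Sum>j<nm. Bblock N0 Bm $$ (i,j) * x (np + N0 + j))"
    by simp
qed

lemma Q_lam_row_sum: "i < N0 \<Longrightarrow> (\<Sum>j<N0. (Q - dmat N0 lam) $$ (i,j)) = - lam i"
proof -
  assume i: "i < N0"
  then have "(\<Sum>j<N0. (Q - dmat N0 lam) $$ (i,j)) = (\<Sum>j<N0. Q $$ (i,j) - (if j = i then lam i else 0))"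
    by (intro sum.cong) (auto simp: dmat_def)
  then show ?thesis using i Q_generator by (simp add: sum_subtractf generator_real_def)
qed

lemma N_cases:
  assumes "i < N"
  obtains "i < np" | k where "k < N0" "i = np + k" | k where "k < nm" "i = np + N0 + k"
proof -
  have "i < np \<or> (i - np < N0 \<and> i = np + (i - np)) \<or> (i - (np + N0) < nm \<and> i = np + N0 + (i - (np + N0)))"
    using assms by auto
  then show ?thesis using that by blast
qed

text \<open>Exit rates balance the phase transitions, and in a regime row the upward and downward
  jump rates add up to the \<open>lam\<close> removed from the diagonal.\<close>

lemma Q0_row_sum_0: assumes "i < N" shows "(\<Sum>j<N. Q0 $$ (i,j)) = 0"
  using assms
proof (cases rule: N_cases)
  case 1
  then show ?thesis using Q0_row_sum(1)[OF 1, of "\<lambda>_. 1"] up.Bblock_bblock_row_sum[OF 1] by simp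
next
  case (2 k)
  then show ?thesis
    using Q0_row_sum(2)[OF 2(1), of "\<lambda>_. 1"] up.Ablock_row_sum[OF 2(1)] down.Ablock_row_sum[OF 2(1)]
      Q_lam_row_sum[OF 2(1)] by (simp add: algebra_simps)
next
  case (3 k)
  then show ?thesis using Q0_row_sum(3)[OF 3(1), of "\<lambda>_. 1"] down.Bblock_bblock_row_sum[OF 3(1)] by simp
qed

lemma Q0_off_diag:
  assumes i: "i < N" and j: "j < N" and "i \<noteq> j" shows "0 \<le> Q0 $$ (i,j)"
proof -
  have "0 \<le> (Q - dmat N0 lam) $$ (k,l)" if "k < N0" "l < N0" "k \<noteq> l" for k l
    using that Q_generator by (auto simp: dmat_def generator_real_def)
  then show ?thesis
    unfolding Q0_block3_index(2)[OF i j]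
    using assms by (auto intro!: up.Bblock_off_diag up.bblock_nonneg up.Ablock_nonneg
        down.Bblock_off_diag down.bblock_nonneg down.Ablock_nonneg simp del: index_minus_mat)
qed

text \<open>States with \<open>Re h = 0\<close> can only be phases, and there the mean absorption
  time has drift -1.\<close>

lemma obtain_weight:
  assumes h: "\<And>i. i < N \<Longrightarrow> 0 \<le> Re (h i)" "\<And>i. i \<in> {np..<np + N0} \<Longrightarrow> 0 < Re (h i)"
  obtains d where "\<And>i. i < N \<Longrightarrow> 0 < d i"
    "\<And>i. i < N \<Longrightarrow> (\<Sum>l<N. Q0 $$ (i,l) * d l) < Re (h i) * d i"
proof -
  obtain wp where wp: "\<And>r. r < np \<Longrightarrow> 0 \<le> wp r"
    "\<And>r. r < np \<Longrightarrow> (\<Sum>s<np. Bblock N0 Bp $$ (r,s) * wp s) = -1"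
    using up.Bblock_hitting_time by metis
  obtain wm where wm: "\<And>r. r < nm \<Longrightarrow> 0 \<le> wm r"
    "\<And>r. r < nm \<Longrightarrow> (\<Sum>s<nm. Bblock N0 Bm $$ (r,s) * wm s) = -1"
    using down.Bblock_hitting_time by metis
  \<comment> \<open>Vanishing on the regimes removes the exit rates from the drift at the
    phases.\<close>
  define w where "w = (\<lambda>i. if i < np then wp i else if i < np + N0 then 0 else wm (i - (np + N0)))"
  have "(\<Sum>l<N. Q0 $$ (i,l) * w l) < 0" if "i < N" "Re (h i) = 0" for i
    using that(1)
  proof (cases rule: N_cases)
    case 1
    then show ?thesis using Q0_row_sum(1)[OF 1, of w] wp(2)[OF 1] by (simp add: w_def)
  next
    case (2 k)
    then show ?thesis using h(2)[of i] that by simp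
  next
    case (3 k)
    then show ?thesis using Q0_row_sum(3)[OF 3(1), of w] wm(2)[OF 3(1)] by (simp add: w_def)
  qed
  moreover have "0 \<le> w i" if "i < N" for i using that wp wm by (auto simp: w_def)
  ultimately obtain d where "\<And>i. i < N \<Longrightarrow> 0 < d i"
    "\<And>i. i < N \<Longrightarrow> (\<Sum>l<N. Q0 $$ (i,l) * d l) < Re (h i) * d i"
    using obtain_drift_weight[of N "\<lambda>i l. Q0 $$ (i,l)" w "\<lambda>i. Re (h i)"] h Q0_row_sum_0 by auto
  then show ?thesis using that by blast
qed

text \<open>The normalised states are the upward phases and the regimes; the free ones are the
  downward phases, where \<open>v\<close> is -1.\<close>

sublocale plus: wh_system N "np + N0" "\<lambda>k. k" "\<lambda>i. (s i)\<^sup>2 / 2" v "\<lambda>i l. Q0 $$ (i,l)"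
proof
  show "0 < (s k)\<^sup>2 / 2 \<or> (s k)\<^sup>2 / 2 = 0 \<and> v k = 1" if "k < np + N0" for k
    using that s_eq_0_iff[of k] by (cases "k < np") (auto simp: v_def)
qed (use N0_pos Q0_off_diag in \<open>auto simp: s_def v_def\<close>)

text \<open>With \<open>v\<close> negated the roles of upward and downward phases are exchanged, and
  the enumeration starts after the upward phases.\<close>

sublocale minus: wh_system N "N0 + nm" "\<lambda>k. np + k" "\<lambda>i. (s i)\<^sup>2 / 2" "\<lambda>i. - v i" "\<lambda>i l. Q0 $$ (i,l)"
proof
  show "0 < (s (np + k))\<^sup>2 / 2 \<or> (s (np + k))\<^sup>2 / 2 = 0 \<and> - v (np + k) = 1" if "k < N0 + nm" for k
    using that s_eq_0_iff[of "np + k"] by (cases "k < N0") (auto simp: v_def)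
  show "(s i)\<^sup>2 / 2 = 0 \<and> - v i = - 1" if "i < N" "i \<notin> (+) np ` {..<N0 + nm}" for i
  proof -
    have "i < np"
    proof (rule ccontr)
      assume "\<not> i < np"
      then have "i = np + (i - np)" "i - np < N0 + nm" using that(1) by auto
      then show False using that(2) by blast
    qed
    then show ?thesis by (simp add: s_def v_def)
  qed
qed (use N0_pos Q0_off_diag in \<open>auto simp: inj_on_def\<close>)

end

theorem theorem5p2:
  fixes N0 :: nat and Q :: "real mat"
    and mu sigma lam p :: "nat \<Rightarrow> real"
    and mp mm :: "nat \<Rightarrow> nat"
    and betap betam :: "nat \<Rightarrow> real vec"
    and Bp Bm :: "nat \<Rightarrow> real mat"
    and h :: "nat \<Rightarrow> complex"
  assumes "0 < N0"
    and "generator_real N0 Q"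
    and "\<forall>i<N0. sigma i > 0"
    and "\<forall>i<N0. lam i \<ge> 0"
    and "\<forall>i<N0. 0 \<le> p i \<and> p i \<le> 1"
    and "\<forall>i<N0. ph_params (mp i) (betap i) (Bp i)"
    and "\<forall>i<N0. ph_params (mm i) (betam i) (Bm i)"
    and "in_calH (Sigma_mat N0 sigma mp mm) h"
  shows
   "(let S = Sigma_mat N0 sigma mp mm; V = V_mat N0 mu mp mm;
         Q0 = Q0_mat N0 Q lam p mp betap Bp mm betam Bm;
         N = dim_row S;
         Qh = map_mat complex_of_real Q0 - dmat N h;
         Sc = map_mat complex_of_real S; Vc = map_mat complex_of_real V;
         Np = card (E0_set S \<union> Eplus_set S V); Nm = card (E0_set S \<union> Eminus_set S V);
         Npu = card (Eplus_set S V); Nmu = card (Eminus_set S V)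
     in (\<exists>!(Wp, Gp, Wm, Gm). is_mat_WH Sc Vc Qh Np Nm Wp Gp Wm Gm) \<and>
        ((\<forall>k<N. Im (h k) = 0) \<longrightarrow>
          (\<forall>Wp Gp Wm Gm. is_mat_WH Sc Vc Qh Np Nm Wp Gp Wm Gm \<longrightarrow>
             in_G Np Gp \<and> in_G Nm Gm \<and> in_H N Np Wp \<and> in_H N Nm Wm \<and>
             (\<exists>L. in_H Nmu Np L \<and> Wp = vstack (1\<^sub>m Np) L) \<and>
             (\<exists>L. in_H Npu Nm L \<and> Wm = vstack L (1\<^sub>m Nm)))))"
proof -
  interpret regime_model N0 Q mu sigma lam p mp mm betap betam Bp Bm
    by unfold_locales (use assms in auto)
  have h: "0 \<le> Re (h i)" if "i < N" for i using assms(8) that by (simp add: in_calH_def S_dim)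
  have h0: "0 < Re (h i)" if "i \<in> {np..<np + N0}" for i
    using assms(8) that unfolding in_calH_def E0_set_eq by blast
  obtain d where d: "\<And>i. i < N \<Longrightarrow> 0 < d i"
    "\<And>i. i < N \<Longrightarrow> (\<Sum>l<N. Q0 $$ (i,l) * d l) < Re (h i) * d i"
    using obtain_weight[of h, OF h h0] by blast
  have rows: "(\<Sum>l<N. Q0 $$ (i,l)) \<le> 0" if "i < N" for i using Q0_row_sum_0[OF that] by simp
  let ?P = "whsol N (np + N0) (\<lambda>k. k) (\<lambda>i. (s i)\<^sup>2 / 2) v (\<lambda>i l. Q0 $$ (i,l)) h"
  let ?M = "whsol N (N0 + nm) (\<lambda>k. np + k) (\<lambda>i. (s i)\<^sup>2 / 2) (\<lambda>i. - v i) (\<lambda>i l. Q0 $$ (i,l)) h"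
  have "\<exists>W G. ?P W G \<and> in_D (np + N0) G \<and>
    (\<forall>W' G'. ?P W' G' \<and> in_D (np + N0) G' \<longrightarrow> W' = W \<and> G' = G) \<and>
    ((\<forall>i<N. Im (h i) = 0) \<longrightarrow> in_G (np + N0) G \<and> in_H N (np + N0) W)"
    by (rule plus.whsol_ex1[of d h]; erule d rows h)
  then obtain Wp Gp where P: "?P Wp Gp" "in_D (np + N0) Gp"
    "\<forall>W' G'. ?P W' G' \<and> in_D (np + N0) G' \<longrightarrow> W' = Wp \<and> G' = Gp"
    "(\<forall>i<N. Im (h i) = 0) \<longrightarrow> in_G (np + N0) Gp \<and> in_H N (np + N0) Wp"
    by (elim exE conjE)
  have "\<exists>W G. ?M W G \<and> in_D (N0 + nm) G \<and>
    (\<forall>W' G'. ?M W' G' \<and> in_D (N0 + nm) G' \<longrightarrow> W' = W \<and> G' = G) \<and>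
    ((\<forall>i<N. Im (h i) = 0) \<longrightarrow> in_G (N0 + nm) G \<and> in_H N (N0 + nm) W)"
    by (rule minus.whsol_ex1[of d h]; erule d rows h)
  then obtain Wm Gm where M: "?M Wm Gm" "in_D (N0 + nm) Gm"
    "\<forall>W' G'. ?M W' G' \<and> in_D (N0 + nm) G' \<longrightarrow> W' = Wm \<and> G' = Gm"
    "(\<forall>i<N. Im (h i) = 0) \<longrightarrow> in_G (N0 + nm) Gm \<and> in_H N (N0 + nm) Wm"
    by (elim exE conjE)
  have cards: "card (E0_set S \<union> Eplus_set S V) = np + N0" "card (E0_set S \<union> Eminus_set S V) = N0 + nm"
    "card (Eplus_set S V) = np" "card (Eminus_set S V) = nm"
  proof -
    have "E0_set S \<union> Eplus_set S V = {..<np + N0}" "E0_set S \<union> Eminus_set S V = {np..<N}"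
      unfolding E0_set_eq Eplus_set_eq Eminus_set_eq by auto
    then show "card (E0_set S \<union> Eplus_set S V) = np + N0" "card (E0_set S \<union> Eminus_set S V) = N0 + nm"
      "card (Eplus_set S V) = np" "card (Eminus_set S V) = nm"
      by (simp_all add: Eplus_set_eq Eminus_set_eq)
  qed
  \<comment> \<open>Matches the row offset in \<open>is_mat_WH\<close> with the enumeration of the
    \<open>minus\<close> instance.\<close>
  have off: "N - (N0 + nm) = np" by simp
  \<comment> \<open>Being a factorisation is the same as being this one quadruple, so unique
    existence is immediate and the real case concerns this quadruple alone.\<close>
  have iff: "is_mat_WH (map_mat complex_of_real S) (map_mat complex_of_real V)
      (map_mat complex_of_real Q0 - dmat N h) (np + N0) (N0 + nm) Wp' Gp' Wm' Gm' \<longleftrightarrow>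
      (Wp', Gp', Wm', Gm') = (Wp, Gp, Wm, Gm)" for Wp' Gp' Wm' Gm'
    unfolding S_dmat V_dmat is_mat_WH_iff[OF Q0_block3_index(1)] off
    using P(1-3) M(1-3) by blast
  have "(\<exists>L. in_H nm (np + N0) L \<and> Wp = vstack (1\<^sub>m (np + N0)) L)" if "\<forall>i<N. Im (h i) = 0"
    by (rule in_H_vstack_top) (use P(1) P(4)[rule_format, OF that[rule_format]] in \<open>auto simp: whsol_def\<close>)
  moreover have "(\<exists>L. in_H np (N0 + nm) L \<and> Wm = vstack L (1\<^sub>m (N0 + nm)))" if "\<forall>i<N. Im (h i) = 0"
    by (rule in_H_vstack_bottom) (use M(1) M(4)[rule_format, OF that[rule_format]] in \<open>auto simp: whsol_def add.assoc\<close>)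
  ultimately show ?thesis
    unfolding Let_def cards S_dim iff using P(4) M(4) by auto
qed

end
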